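(* Let $R$ be a connected multigraph with exactly $m$ edges, where $m \ge 1$, and let $G$ be an $n$-vertex graph. If the maximum $R$-subdivisions in $G$ pairwise intersect (i.e., any two of them have a common vertex), then $\tau_R(G) \le 8 m^{5/4} n^{3/4}$.
   Context: Graphs are finite and simple; multigraphs are finite and may have parallel edges. Given a multigraph $F$ and an edge $e\in E(F)$ with endpoints $u$ and $v$, the subdivision operation produces a new multigraph in which $e$ is replaced by a path $uwv$ through a new vertex $w$. A subdivision of $F$ is a graph obtained from $F$ via a sequence of zero or more subdivision operations. For a multigraph $R$ and a graph $G$, an $R$-subdivision in $G$ is a subgraph of $G$ isomorphic to a subdivision of $R$. A maximum $R$-subdivision in $G$ is an $R$-subdivision $F$ in $G$ that maximizes $|V(F)|$ among all $R$-subdivisions in $G$. An $R$-transversal of $G$ is a set of vertices of $G$ that intersects the vertex set of every maximum $R$-subdivision in $G$. $\tau_R(G)$ denotes the minimum size of an $R$-transversal of $G$. *)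

theory Defs
  imports Complex_Main
begin

record ('v, 'e) mgraph =
  verts :: "'v set"
  edges :: "'e set"
  ends :: "'e \<Rightarrow> 'v set"

text \<open>Parallel edges are distinct edges with the same set of end-vertices. Every edge has two
  distinct end-vertices, so there are no loops. The values of \<open>ends\<close> outside \<open>edges\<close> are
  irrelevant, and all notions below ignore them.\<close>

locale multigraph =
  fixes G :: "('v, 'e) mgraph"
  assumes finite_verts: "finite (verts G)"
    and finite_edges: "finite (edges G)"
    and ends_in_verts: "e \<in> edges G \<Longrightarrow> ends G e \<subseteq> verts G"
    and card_ends: "e \<in> edges G \<Longrightarrow> card (ends G e) = 2"

locale simple_graph = multigraph +
  assumes no_parallel: "inj_on (ends G) (edges G)"

definition adj_rel :: "('v, 'e) mgraph \<Rightarrow> ('v \<times> 'v) set" where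
  "adj_rel G = {(u, v). \<exists>e\<in>edges G. ends G e = {u, v}}"

definition connected_mgraph :: "('v, 'e) mgraph \<Rightarrow> bool" where
  "connected_mgraph G \<longleftrightarrow>
     verts G \<noteq> {} \<and> (\<forall>u\<in>verts G. \<forall>v\<in>verts G. (u, v) \<in> (adj_rel G)\<^sup>*)"

definition subgraph_of :: "('v, 'e) mgraph \<Rightarrow> ('v, 'e) mgraph \<Rightarrow> bool" where
  "subgraph_of H G \<longleftrightarrow>
     multigraph H \<and> verts H \<subseteq> verts G \<and> edges H \<subseteq> edges G \<and>
     (\<forall>e\<in>edges H. ends H e = ends G e)"

definition isomorphic :: "('v, 'e) mgraph \<Rightarrow> ('w, 'f) mgraph \<Rightarrow> bool" where
  "isomorphic G H \<longleftrightarrow>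
     (\<exists>f g. bij_betw f (verts G) (verts H) \<and> bij_betw g (edges G) (edges H) \<and>
        (\<forall>e\<in>edges G. ends H (g e) = f ` ends G e))"

text \<open>One subdivision operation: the edge \<open>e = uv\<close> is replaced by the path \<open>u w v\<close> through the
  new vertex \<open>w\<close>, whose edges are \<open>e\<^sub>1\<close> and \<open>e\<^sub>2\<close>.\<close>

definition subdivide_edge :: "('v, 'e) mgraph \<Rightarrow> ('v, 'e) mgraph \<Rightarrow> bool" where
  "subdivide_edge F F' \<longleftrightarrow>
     (\<exists>e u v w e\<^sub>1 e\<^sub>2.
        e \<in> edges F \<and> ends F e = {u, v} \<and> w \<notin> verts F \<and>
        e\<^sub>1 \<notin> edges F \<and> e\<^sub>2 \<notin> edges F \<and> e\<^sub>1 \<noteq> e\<^sub>2 \<and>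
        verts F' = insert w (verts F) \<and>
        edges F' = insert e\<^sub>1 (insert e\<^sub>2 (edges F - {e})) \<and>
        ends F' e\<^sub>1 = {u, w} \<and> ends F' e\<^sub>2 = {w, v} \<and>
        (\<forall>d\<in>edges F - {e}. ends F' d = ends F d))"

text \<open>Subdividing needs fresh vertices and fresh edges, which the types of \<open>R\<close> and \<open>G\<close> may fail to
  provide. The subdivision is therefore carried out on copies with natural numbers as vertices and
  edges; as all multigraphs are finite, such copies exist and fresh names never run out. This is no
  restriction, since subdivisions are only considered up to isomorphism.\<close>

definition is_subdivision_in :: "('a, 'b) mgraph \<Rightarrow> ('v, 'e) mgraph \<Rightarrow> ('v, 'e) mgraph \<Rightarrow> bool" where
  "is_subdivision_in R G H \<longleftrightarrow>
     subgraph_of H G \<and>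
     (\<exists>R' F :: (nat, nat) mgraph.
        isomorphic R R' \<and> subdivide_edge\<^sup>*\<^sup>* R' F \<and> isomorphic F H)"

definition is_max_subdivision_in :: "('a, 'b) mgraph \<Rightarrow> ('v, 'e) mgraph \<Rightarrow> ('v, 'e) mgraph \<Rightarrow> bool" where
  "is_max_subdivision_in R G H \<longleftrightarrow>
     is_subdivision_in R G H \<and>
     (\<forall>H'. is_subdivision_in R G H' \<longrightarrow> card (verts H') \<le> card (verts H))"

definition transversal :: "('a, 'b) mgraph \<Rightarrow> ('v, 'e) mgraph \<Rightarrow> 'v set \<Rightarrow> bool" where
  "transversal R G S \<longleftrightarrow>
     S \<subseteq> verts G \<and> (\<forall>H. is_max_subdivision_in R G H \<longrightarrow> S \<inter> verts H \<noteq> {})"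

text \<open>The minimum is over a nonempty set whenever \<open>R\<close> has a vertex, because then \<open>verts G\<close> is a
  transversal; it is 0 if \<open>G\<close> contains no \<open>R\<close>-subdivision.\<close>

definition tau :: "('a, 'b) mgraph \<Rightarrow> ('v, 'e) mgraph \<Rightarrow> nat" where
  "tau R G = (LEAST k. \<exists>S. transversal R G S \<and> card S = k)"

end

theory Submission
  imports Defs
begin

text \<open>The vertex sets of the maximum subdivisions are connected and pairwise intersecting, so any two
  sets \<open>A\<close>, \<open>B\<close> that are hard to separate from them are joined by many disjoint paths
  (Menger). For a vertex set \<open>X\<close> let \<open>\<nu>(X)\<close> be the least number of vertices meeting all maximum
  subdivisions that meet \<open>X\<close>, and put \<open>t = \<tau>\<^sub>R(G)\<close>. One of the \<open>m\<close> subdivided edges of a maximum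
  subdivision contains a path \<open>A M B\<close> with \<open>\<nu>(A)\<close>, \<open>\<nu>(M)\<close>, \<open>\<nu>(B)\<close> of order \<open>r = t / 4m\<close>. Among
  \<open>r\<close> disjoint paths from \<open>A\<close> to \<open>B\<close> one has at most \<open>n / r\<close> vertices; as it jumps over \<open>M\<close> in at
  most \<open>n / r\<close> jumps, one jump closes a cycle \<open>C\<close> with \<open>s = \<nu>(C) \<ge> r\<^sup>2 / n\<close>. Some maximum
  subdivision \<open>F\<close> avoids \<open>C\<close>, and \<open>s\<close> disjoint paths link \<open>C\<close> to \<open>F\<close>. By maximality, rerouting
  \<open>F\<close> through the longer arc of \<open>C\<close> gains nothing, so links ending on the same subdivided edge of
  \<open>F\<close> end at distance at least \<open>s / 2\<close>. Hence \<open>s\<^sup>2 \<le> 2 m n + m s\<close>, which bounds \<open>t\<close>.\<close>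

section \<open>Menger's theorem\<close>

text \<open>Paths are vertex lists over an arbitrary relation, so Menger's theorem below is the
  directed version. A single vertex is a path; hence every separator of \<open>A\<close> and
  \<open>B\<close> contains \<open>A \<inter> B\<close>.\<close>

definition is_path :: "('v \<times> 'v) set \<Rightarrow> 'v list \<Rightarrow> bool" where
  "is_path E p \<longleftrightarrow> p \<noteq> [] \<and> distinct p \<and> successively (\<lambda>u v. (u, v) \<in> E) p"

definition separates :: "('v \<times> 'v) set \<Rightarrow> 'v set \<Rightarrow> 'v set \<Rightarrow> 'v set \<Rightarrow> bool" where
  "separates E A B S \<longleftrightarrow> (\<forall>p. is_path E p \<and> hd p \<in> A \<and> last p \<in> B \<longrightarrow> set p \<inter> S \<noteq> {})"

text \<open>Inner vertices of the paths may lie in \<open>A\<close> or \<open>B\<close> as well;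
  \<open>path_trim\<close> shortens the paths where this matters.\<close>

definition disjoint_paths ::
    "('v \<times> 'v) set \<Rightarrow> 'v set \<Rightarrow> 'v set \<Rightarrow> 'v list set \<Rightarrow> bool" where
  "disjoint_paths E A B P \<longleftrightarrow> finite P \<and> (\<forall>p\<in>P. is_path E p \<and> hd p \<in> A \<and> last p \<in> B) \<and>
     (\<forall>p\<in>P. \<forall>q\<in>P. p \<noteq> q \<longrightarrow> set p \<inter> set q = {})"

lemma is_path_mono: "is_path E p \<Longrightarrow> E \<subseteq> E' \<Longrightarrow> is_path E' p"
  unfolding is_path_def by (auto elim!: successively_mono)

text \<open>If the new first vertex already lies on the path found for the rest of the walk, that
  path is started at this vertex instead.\<close>

lemma walk_imp_path:
  assumes "xs \<noteq> []" "successively (\<lambda>u v. (u, v) \<in> E) xs"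
  shows "\<exists>p. is_path E p \<and> hd p = hd xs \<and> last p = last xs \<and> set p \<subseteq> set xs"
  using assms
proof (induction xs rule: list_nonempty_induct)
  case (single x)
  then show ?case by (intro exI[of _ "[x]"]) (auto simp: is_path_def)
next
  case (cons x xs)
  then have "successively (\<lambda>u v. (u, v) \<in> E) xs" "(x, hd xs) \<in> E"
    by (auto simp: successively_Cons)
  with cons obtain p where p: "is_path E p" "hd p = hd xs" "last p = last xs" "set p \<subseteq> set xs"
    by auto
  show ?case
  proof (cases "x \<in> set p")
    case True
    then obtain ys zs where s: "p = ys @ x # zs" by (meson split_list)
    with p show ?thesis
      by (intro exI[of _ "x # zs"]) (use cons in \<open>auto simp: is_path_def successively_append_iff\<close>)
  next
    case False
    with p \<open>(x, hd xs) \<in> E\<close> show ?thesis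
      by (intro exI[of _ "x # p"]) (use cons in \<open>auto simp: is_path_def successively_Cons\<close>)
  qed
qed

text \<open>The arc \<open>(x, y)\<close> can be used only to leave \<open>x\<close>, and of the
  vertices of \<open>ys @ [z]\<close> only the last can be \<open>x\<close>.\<close>

lemma is_path_initial_segment:
  assumes "is_path (insert (x, y) E) (ys @ z # zs)" "x \<notin> set ys"
  shows "is_path E (ys @ [z])"
  using assms
proof (induction ys)
  case Nil
  then show ?case by (auto simp: is_path_def)
next
  case (Cons a ys)
  then have "is_path E (ys @ [z])" by (auto simp: is_path_def successively_Cons)
  with Cons show ?case by (cases ys) (auto simp: is_path_def successively_Cons)
qed

text \<open>Dually, \<open>(x, y)\<close> can be used only to enter \<open>y\<close>, and in
  \<open>z # zs\<close> only the first vertex can be \<open>y\<close>.\<close>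

lemma is_path_final_segment:
  assumes "is_path (insert (x, y) E) (ys @ z # zs)" "y \<notin> set zs"
  shows "is_path E (z # zs)"
  using assms(2,1)
proof (induction zs arbitrary: ys z)
  case Nil
  then show ?case by (auto simp: is_path_def)
next
  case (Cons a zs)
  from Cons.prems(2) have p: "is_path (insert (x, y) E) ((ys @ [z]) @ a # zs)" by simp
  from Cons.IH[OF _ this] Cons.prems(1) have "is_path E (a # zs)" by simp
  with Cons.prems show ?case by (auto simp: is_path_def successively_append_iff)
qed

lemma disjoint_paths_unique:
  "disjoint_paths E A B P \<Longrightarrow> p \<in> P \<Longrightarrow> q \<in> P \<Longrightarrow> v \<in> set p \<Longrightarrow> v \<in> set q \<Longrightarrow> p = q"
  unfolding disjoint_paths_def by blast

text \<open>Disjointness makes the map from paths to their endpoints in \<open>T\<close> injective,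
  and equal cardinalities make it onto.\<close>

lemma endpoint_choice:
  assumes "disjoint_paths E A B P" "\<And>p. p \<in> P \<Longrightarrow> f p \<in> set p \<and> f p \<in> T"
    and "finite T" "card T = card P"
  shows "\<exists>g. \<forall>s\<in>T. g s \<in> P \<and> f (g s) = s"
proof -
  have "inj_on f P" using assms(1,2) disjoint_paths_unique by (metis inj_onI)
  moreover have "f ` P \<subseteq> T" using assms by auto
  ultimately have "f ` P = T"
    using assms(3,4) by (metis card_image card_subset_eq)
  then show ?thesis by (intro exI[of _ "inv_into P f"]) (auto simp: inv_into_into f_inv_into_f)
qed

text \<open>Induction on the edges, after Goering. If deleting \<open>(x, y)\<close> creates a smaller separator
  \<open>S\<close>, then \<open>S \<union> {x}\<close> and \<open>S \<union> {y}\<close> are minimum separators, and the paths from \<open>A\<close> to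
  \<open>S \<union> {x}\<close> and from \<open>S \<union> {y}\<close> to \<open>B\<close> can be glued, because \<open>S\<close> keeps them apart.\<close>

theorem menger:
  assumes "finite E" "finite A"
    and "\<And>S. finite S \<Longrightarrow> separates E A B S \<Longrightarrow> k \<le> card S"
  shows "\<exists>P. disjoint_paths E A B P \<and> card P = k"
  using assms
proof (induction E arbitrary: A B k rule: finite_induct)
  case empty
  have path1: "is_path {} p \<longleftrightarrow> (\<exists>v. p = [v])" for p :: "'a list"
    by (cases p; cases "tl p") (auto simp: is_path_def)
  have "separates {} A B (A \<inter> B)" by (auto simp: separates_def path1)
  then have "k \<le> card (A \<inter> B)" using empty by blast
  then obtain T where T: "T \<subseteq> A \<inter> B" "card T = k" "finite T"
    by (metis obtain_subset_with_card_n)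
  then show ?case
    by (intro exI[of _ "(\<lambda>v. [v]) ` T"])
       (auto simp: disjoint_paths_def path1 card_image inj_on_def)
next
  case (insert e E)
  obtain x y where e: "e = (x, y)" by (cases e)
  show ?case
  proof (cases "\<forall>S. finite S \<and> separates E A B S \<longrightarrow> k \<le> card S")
    case True
    with insert.IH[OF insert.prems(1)] obtain P where "disjoint_paths E A B P" "card P = k" by blast
    moreover from this have "disjoint_paths (insert e E) A B P"
      unfolding disjoint_paths_def by (meson is_path_mono subset_insertI)
    ultimately show ?thesis by blast
  next
    case False
    then obtain S where S: "finite S" "separates E A B S" "card S < k" by force
    \<comment> \<open>A path that avoids \<open>x\<close> or \<open>y\<close> cannot use the arc
      \<open>(x, y)\<close>; it is then a path in \<open>E\<close>, which \<open>S\<close>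
      meets.\<close>
    have hit: "set p \<inter> insert z S \<noteq> {}"
      if pe: "is_path (insert e E) p" and ab: "hd p \<in> A" "last p \<in> B" and "z = x \<or> z = y" for p z
    proof (rule ccontr)
      assume "\<not> ?thesis"
      then have z: "z \<notin> set p" "set p \<inter> S = {}" by auto
      obtain a l where p: "p = a # l"
        using pe by (auto simp: is_path_def neq_Nil_conv)
      have "is_path E p"
      proof (cases "z = x")
        case True
        then show ?thesis
          using is_path_initial_segment[of x y E "butlast p" "last p" "[]"] z pe e
          by (metis append_butlast_last_id in_set_butlastD is_path_def)
      next
        case False
        then show ?thesis
          using is_path_final_segment[of x y E "[]" a l] z pe \<open>z = x \<or> z = y\<close> e p by auto
      qed
      with S(2) ab z(2) show False by (auto simp: separates_def)
    qed
    have sep: "separates (insert e E) A B (insert z S)" if "z = x \<or> z = y" for z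
      using hit that unfolding separates_def by blast
    \<comment> \<open>Both sets have at least \<open>k\<close> elements by hypothesis and at most
      \<open>card S + 1 \<le> k\<close>. This also forces \<open>x\<close> and \<open>y\<close> out
      of \<open>S\<close>.\<close>
    have kx: "card (insert x S) = k" "card (insert y S) = k"
      using insert.prems(2)[of "insert x S"] insert.prems(2)[of "insert y S"] sep S
      by (auto simp: card_insert_if split: if_splits)
    \<comment> \<open>Up to its first vertex in \<open>insert x S\<close> a path from
      \<open>A\<close> to \<open>B\<close> does not use \<open>(x, y)\<close>, so \<open>T\<close>
      meets this initial segment.\<close>
    have "k \<le> card T" if T: "finite T" "separates E A (insert x S) T" for T
    proof (rule insert.prems(2)[OF T(1)])
      show "separates (insert e E) A B T"
        unfolding separates_def
      proof (intro allI impI)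
        fix p assume p: "is_path (insert e E) p \<and> hd p \<in> A \<and> last p \<in> B"
        then have "\<exists>v\<in>set p. v \<in> insert x S" using hit by blast
        then obtain ys z zs where s: "p = ys @ z # zs" "z \<in> insert x S"
            "\<forall>v\<in>set ys. v \<notin> insert x S"
          using split_list_first_prop[of p "\<lambda>v. v \<in> insert x S"] by blast
        then have "is_path E (ys @ [z])" using is_path_initial_segment[of x y E ys z zs] p e by auto
        moreover have "hd (ys @ [z]) \<in> A" using p s by (cases ys) auto
        ultimately have "set (ys @ [z]) \<inter> T \<noteq> {}"
          using T(2) s(2) unfolding separates_def by (metis last_snoc)
        then show "set p \<inter> T \<noteq> {}" using s by auto
      qed
    qed
    then obtain P1 where P1: "disjoint_paths E A (insert x S) P1" "card P1 = k"
      using insert.IH[OF insert.prems(1)] by blast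
    have "k \<le> card T" if T: "finite T" "separates E (insert y S) B T" for T
    proof (rule insert.prems(2)[OF T(1)])
      show "separates (insert e E) A B T"
        unfolding separates_def
      proof (intro allI impI)
        fix p assume p: "is_path (insert e E) p \<and> hd p \<in> A \<and> last p \<in> B"
        then have "\<exists>v\<in>set p. v \<in> insert y S" using hit by blast
        then obtain ys z zs where s: "p = ys @ z # zs" "z \<in> insert y S"
            "\<forall>v\<in>set zs. v \<notin> insert y S"
          using split_list_last_prop[of p "\<lambda>v. v \<in> insert y S"] by blast
        then have "is_path E (z # zs)" using is_path_final_segment[of x y E ys z zs] p e by auto
        moreover have "last (z # zs) \<in> B" using p s by (cases zs) auto
        ultimately have "set (z # zs) \<inter> T \<noteq> {}"
          using T(2) s(2) unfolding separates_def by (metis list.sel(1))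
        then show "set p \<inter> T \<noteq> {}" using s by auto
      qed
    qed
    then obtain P2 where P2: "disjoint_paths E (insert y S) B P2" "card P2 = k"
      using insert.IH[of "insert y S"] S(1) by blast
    have "\<exists>g. \<forall>s\<in>insert x S. g s \<in> P1 \<and> last (g s) = s"
      using P1 kx S by (intro endpoint_choice[OF P1(1)]) (auto simp: disjoint_paths_def is_path_def)
    then obtain f where f: "\<And>s. s \<in> insert x S \<Longrightarrow> f s \<in> P1 \<and> last (f s) = s"
      by blast
    have "\<exists>g. \<forall>s\<in>insert y S. g s \<in> P2 \<and> hd (g s) = s"
      using P2 kx S by (intro endpoint_choice[OF P2(1)]) (auto simp: disjoint_paths_def is_path_def)
    then obtain g where g: "\<And>s. s \<in> insert y S \<Longrightarrow> g s \<in> P2 \<and> hd (g s) = s"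
      by blast
    have fp: "is_path E (f s)" "hd (f s) \<in> A" if "s \<in> insert x S" for s
      using f[OF that] P1 by (auto simp: disjoint_paths_def)
    have gp: "is_path E (g s)" "last (g s) \<in> B" if "s \<in> insert y S" for s
      using g[OF that] P2 by (auto simp: disjoint_paths_def)
    have mem: "s \<in> insert x S \<Longrightarrow> s \<in> set (f s)" "s' \<in> insert y S \<Longrightarrow> s' \<in> set (g s')" for s s'
      using fp gp f g by (metis is_path_def last_in_set) (metis gp(1) g hd_in_set is_path_def)
    have fu: "s = s'" if "s \<in> insert x S" "s' \<in> insert x S" "v \<in> set (f s)" "v \<in> set (f s')" for s s' v
      using disjoint_paths_unique[OF P1(1)] f that by metis
    have gu: "s = s'" if "s \<in> insert y S" "s' \<in> insert y S" "v \<in> set (g s)" "v \<in> set (g s')" for s s' v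
      using disjoint_paths_unique[OF P2(1)] g that by metis
    \<comment> \<open>Switching from \<open>f s\<close> to \<open>g t\<close> at \<open>v\<close>
      gives a walk from \<open>A\<close> to \<open>B\<close> in \<open>E\<close>, which meets
      \<open>S\<close> in some \<open>r\<close>. By disjointness \<open>r\<close> is the last vertex
      \<open>s\<close> of \<open>f s\<close> or the first vertex \<open>t\<close> of
      \<open>g t\<close>. As \<open>r\<close> comes no later than \<open>v\<close> on
      \<open>f s\<close>, or no earlier than \<open>v\<close> on \<open>g t\<close>, it equals
      \<open>v\<close>.\<close>
    have fg: "v = s \<and> v = t \<and> v \<in> S"
      if st: "s \<in> insert x S" "t \<in> insert y S" and v: "v \<in> set (f s)" "v \<in> set (g t)" for s t v
    proof -
      obtain al be where al: "f s = al @ v # be" using v by (meson split_list)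
      obtain ga de where ga: "g t = ga @ v # de" using v by (meson split_list)
      have "successively (\<lambda>u v. (u, v) \<in> E) (al @ v # de)"
        using fp(1)[OF st(1)] gp(1)[OF st(2)] al ga
        by (auto simp: is_path_def successively_append_iff successively_Cons)
      from walk_imp_path[OF _ this] obtain p where p: "is_path E p" "hd p = hd (al @ v # de)"
        "last p = last (al @ v # de)" "set p \<subseteq> set (al @ v # de)" by auto
      moreover have "hd (al @ v # de) \<in> A" using fp(2)[OF st(1)] al by (cases al) auto
      moreover have "last (al @ v # de) \<in> B" using gp(2)[OF st(2)] ga by auto
      ultimately obtain r where r: "r \<in> S" "r \<in> set (al @ v # de)"
        using S(2) unfolding separates_def by (metis disjoint_iff subsetD)
      show ?thesis
      proof (cases "r \<in> set (al @ [v])")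
        case True
        then have "r = s" using fu[of r s r] r st mem al by auto
        with f[OF st(1)] True al fp(1)[OF st(1)] have "v = s"
          by (auto simp: is_path_def split: if_splits)
        moreover from this have "v = t" using gu[of v t v] r st mem(2)[of v] v \<open>r = s\<close> by auto
        ultimately show ?thesis using r \<open>r = s\<close> by auto
      next
        case False
        then have rg: "r \<in> set (v # de)" using r by auto
        then have "r = t" using gu[of r t r] r st mem ga by auto
        with g[OF st(2)] rg ga gp(1)[OF st(2)] have "v = t"
          by (cases ga) (auto simp: is_path_def)
        moreover from this have "v = s" using fu[of v s v] r st mem(1)[of v] v \<open>r = t\<close> by auto
        ultimately show ?thesis using r \<open>r = t\<close> by auto
      qed
    qed
    have xy: "x \<notin> S" "y \<notin> S" using kx S by (auto simp: insert_absorb)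
    \<comment> \<open>For \<open>s\<close> in \<open>S\<close> the two paths share \<open>s\<close>,
      which is kept once. The path ending in \<open>x\<close> and the path starting in
      \<open>y\<close> are joined by the restored arc \<open>(x, y)\<close>.\<close>
    define h where "h s = (if s = x then f x @ g y else f s @ tl (g s))" for s
    have seth: "set (h s) = set (f s) \<union> set (g (if s = x then y else s))" if "s \<in> insert x S" for s
    proof (cases "s = x")
      case False
      then have "s \<in> set (f s)" "g s \<noteq> []" "hd (g s) = s" using that mem gp g by (auto simp: is_path_def)
      then show ?thesis using False by (cases "g s") (auto simp: h_def)
    qed (auto simp: h_def)
    have hp: "is_path (insert e E) (h s) \<and> hd (h s) \<in> A \<and> last (h s) \<in> B" if s: "s \<in> insert x S" for s
    proof (cases "s = x")
      case True
      have "set (f x) \<inter> set (g y) = {}" using fg[of x y] xy by auto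
      moreover have "is_path (insert e E) (f x)" "is_path (insert e E) (g y)"
        using fp(1)[of x] gp(1)[of y] by (auto intro: is_path_mono)
      moreover have "last (f x) = x" "hd (g y) = y" using f g by auto
      ultimately show ?thesis using True e fp(2)[of x] gp(2)[of y]
        by (auto simp: h_def is_path_def successively_append_iff)
    next
      case False
      then have sS: "s \<in> S" using s by auto
      then obtain l where l: "g s = s # l"
        using gp(1)[of s] g[of s] by (metis insertCI is_path_def list.exhaust_sel)
      have "set (f s) \<inter> set l = {}" using fg[of s s] sS l gp(1)[of s] by (auto simp: is_path_def)
      moreover have "is_path (insert e E) (f s)" "is_path (insert e E) (s # l)"
        using fp(1)[of s] gp(1)[of s] sS l by (auto intro: is_path_mono)
      moreover have "last (f s) = s" using f sS by auto
      moreover have "l = [] \<or> last l \<in> B" "l = [] \<Longrightarrow> s \<in> B" using gp(2)[of s] l sS by (auto split: if_splits)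
      ultimately show ?thesis using False l fp(2)[of s] sS
        by (auto simp: h_def is_path_def successively_append_iff successively_Cons last_append)
    qed
    have hu: "s = s'" if s: "s \<in> insert x S" "s' \<in> insert x S" and v: "v \<in> set (h s)" "v \<in> set (h s')" for s s' v
    proof -
      let ?c = "\<lambda>s. if s = x then y else s"
      have c: "?c s \<in> insert y S" "?c s' \<in> insert y S" using s by auto
      from v consider "v \<in> set (f s)" "v \<in> set (f s')" | "v \<in> set (f s)" "v \<in> set (g (?c s'))"
        | "v \<in> set (g (?c s))" "v \<in> set (f s')" | "v \<in> set (g (?c s))" "v \<in> set (g (?c s'))"
        using seth s by blast
      then show ?thesis
      proof cases
        case 1 then show ?thesis using fu s by blast
      next
        case 2 then show ?thesis using fg[OF s(1) c(2)] xy by (auto split: if_splits)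
      next
        case 3 then show ?thesis using fg[OF s(2) c(1)] xy by (auto split: if_splits)
      next
        case 4 then show ?thesis using gu[OF c] xy s by (auto split: if_splits)
      qed
    qed
    have "inj_on h (insert x S)"
    proof (rule inj_onI)
      fix s s' assume a: "s \<in> insert x S" "s' \<in> insert x S" "h s = h s'"
      have "hd (h s) \<in> set (h s)" using hp[OF a(1)] by (auto simp: is_path_def)
      then show "s = s'" using hu a by metis
    qed
    then have "card (h ` insert x S) = k" using kx by (metis card_image)
    moreover have "disjoint_paths (insert e E) A B (h ` insert x S)"
      unfolding disjoint_paths_def
    proof (intro conjI ballI impI)
      show "set p \<inter> set q = {}" if "p \<in> h ` insert x S" "q \<in> h ` insert x S" "p \<noteq> q" for p q
        using hu that by blast
    qed (use S hp in auto)
    ultimately show ?thesis by blast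
  qed
qed

section \<open>Models of subdivisions\<close>

text \<open>The edges are listed explicitly because parallel edges are not determined by their
  ends.\<close>

fun walk_edges :: "('v, 'e) mgraph \<Rightarrow> 'v list \<Rightarrow> 'e list \<Rightarrow> bool" where
  "walk_edges H [u] [] = True"
| "walk_edges H (u # v # vs) (e # es) = (ends H e = {u, v} \<and> walk_edges H (v # vs) es)"
| "walk_edges H _ _ = False"

text \<open>The branch vertices are \<open>\<phi> ` verts R\<close>, and the edge \<open>e\<close> of \<open>R\<close> becomes the path with
  vertices \<open>p e\<close> and edges \<open>q e\<close>.\<close>

definition topological_model ::
    "('a, 'b) mgraph \<Rightarrow> ('v, 'e) mgraph \<Rightarrow> ('a \<Rightarrow> 'v) \<Rightarrow> ('b \<Rightarrow> 'v list) \<Rightarrow> ('b \<Rightarrow> 'e list) \<Rightarrow> bool" where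
  "topological_model R H \<phi> p q \<longleftrightarrow>
     inj_on \<phi> (verts R) \<and>
     (\<forall>e\<in>edges R. walk_edges H (p e) (q e) \<and> distinct (p e) \<and>
        \<phi> ` ends R e = {hd (p e), last (p e)} \<and>
        set (p e) \<inter> \<phi> ` verts R \<subseteq> {hd (p e), last (p e)} \<and>
        distinct (q e)) \<and>
     (\<forall>e\<in>edges R. \<forall>e'\<in>edges R. e \<noteq> e' \<longrightarrow>
        set (p e) \<inter> set (p e') \<subseteq> \<phi> ` verts R \<and> set (q e) \<inter> set (q e') = {}) \<and>
     verts H = \<phi> ` verts R \<union> (\<Union>e\<in>edges R. set (p e)) \<and>
     edges H = (\<Union>e\<in>edges R. set (q e))"

lemma walk_edges_length: "walk_edges H vs es \<Longrightarrow> length vs = Suc (length es)"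
  by (induction H vs es rule: walk_edges.induct) auto

lemma walk_edges_not_Nil: "walk_edges H vs es \<Longrightarrow> vs \<noteq> []"
  using walk_edges_length by fastforce

lemma walk_edges_cong:
  assumes "\<And>e. e \<in> set es \<Longrightarrow> ends H' e = ends H e"
  shows "walk_edges H' vs es = walk_edges H vs es"
  using assms by (induction H vs es rule: walk_edges.induct) auto

lemma walk_edges_append:
  "walk_edges H (xs @ y # ys) (es @ fs)
    \<longleftrightarrow> walk_edges H (xs @ [y]) es \<and> walk_edges H (y # ys) fs" if "length xs = length es"
  using that
proof (induction xs es rule: list_induct2)
  case (Cons x xs e es)
  then show ?case by (cases xs) auto
qed auto

lemma walk_edges_split:
  assumes "walk_edges H (xs @ y # ys) es"
  obtains es1 es2 where "es = es1 @ es2" "walk_edges H (xs @ [y]) es1" "walk_edges H (y # ys) es2"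
proof -
  have l: "length (take (length xs) es) = length xs" using walk_edges_length[OF assms] by auto
  show ?thesis
    using walk_edges_append[of xs "take (length xs) es" H y ys "drop (length xs) es"] assms l
    by (intro that[of "take (length xs) es" "drop (length xs) es"]) auto
qed

lemma walk_edges_split_edge:
  assumes "walk_edges H vs (es1 @ e # es2)"
  obtains xs y z zs where "vs = xs @ y # z # zs" "walk_edges H (xs @ [y]) es1" "ends H e = {y, z}"
    "walk_edges H (z # zs) es2"
proof -
  let ?n = "length es1"
  have l: "length vs = Suc (length es1 + Suc (length es2))" using walk_edges_length[OF assms] by simp
  define xs zs where "xs = take ?n vs" and "zs = drop (Suc (Suc ?n)) vs"
  have vs: "vs = xs @ vs ! ?n # vs ! Suc ?n # zs"
    using l by (simp add: xs_def zs_def id_take_nth_drop[symmetric] Cons_nth_drop_Suc)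
  have "walk_edges H (xs @ [vs ! ?n]) es1 \<and> walk_edges H (vs ! ?n # vs ! Suc ?n # zs) (e # es2)"
    using walk_edges_append[of xs es1 H "vs ! ?n" "vs ! Suc ?n # zs" "e # es2"] assms vs l
    by (simp add: xs_def)
  then show ?thesis using that vs by auto
qed

lemma walk_edges_ends_subset: "walk_edges H vs es \<Longrightarrow> e \<in> set es \<Longrightarrow> ends H e \<subseteq> set vs"
  by (induction H vs es rule: walk_edges.induct) auto

lemma walk_edges_distinct: "walk_edges H vs es \<Longrightarrow> distinct vs \<Longrightarrow> distinct es"
proof (induction H vs es rule: walk_edges.induct)
  case (2 H u v vs e es)
  then have "u \<notin> ends H e'" if "e' \<in> set es" for e'
    using walk_edges_ends_subset[of H "v # vs" es e'] that by auto
  with 2 show ?case by auto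
qed auto

lemma walk_edges_successively:
  "walk_edges H vs es \<Longrightarrow> set es \<subseteq> edges G \<Longrightarrow> (\<And>e. e \<in> set es \<Longrightarrow> ends G e = ends H e) \<Longrightarrow>
    successively (\<lambda>u v. (u, v) \<in> adj_rel G) vs"
  by (induction H vs es rule: walk_edges.induct) (auto simp: adj_rel_def)

lemma successively_walk_edges:
  "successively (\<lambda>u v. (u, v) \<in> adj_rel G) vs \<Longrightarrow> vs \<noteq> [] \<Longrightarrow>
    \<exists>es. walk_edges G vs es \<and> set es \<subseteq> edges G"
proof (induction vs rule: induct_list012)
  case (2 x)
  then show ?case by (intro exI[of _ "[]"]) auto
next
  case (3 x y zs)
  then obtain es where "walk_edges G (y # zs) es" "set es \<subseteq> edges G" by auto
  moreover obtain e where "e \<in> edges G" "ends G e = {x, y}" using 3 by (auto simp: adj_rel_def)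
  ultimately show ?case by (intro exI[of _ "e # es"]) auto
qed auto

lemma
  assumes "topological_model R H \<phi> p q"
  shows model_inj: "inj_on \<phi> (verts R)"
    and model_verts: "verts H = \<phi> ` verts R \<union> (\<Union>e\<in>edges R. set (p e))"
    and model_edges: "edges H = (\<Union>e\<in>edges R. set (q e))"
    and model_walk: "e \<in> edges R \<Longrightarrow> walk_edges H (p e) (q e)"
    and model_distinct: "e \<in> edges R \<Longrightarrow> distinct (p e)" "e \<in> edges R \<Longrightarrow> distinct (q e)"
    and model_ends: "e \<in> edges R \<Longrightarrow> \<phi> ` ends R e = {hd (p e), last (p e)}"
    and model_branch: "e \<in> edges R \<Longrightarrow> set (p e) \<inter> \<phi> ` verts R \<subseteq> {hd (p e), last (p e)}"
    and model_meet: "e \<in> edges R \<Longrightarrow> e' \<in> edges R \<Longrightarrow> e \<noteq> e' \<Longrightarrow> set (p e) \<inter> set (p e') \<subseteq> \<phi> ` verts R"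
      "e \<in> edges R \<Longrightarrow> e' \<in> edges R \<Longrightarrow> e \<noteq> e' \<Longrightarrow> set (q e) \<inter> set (q e') = {}"
  using assms unfolding topological_model_def by simp_all

lemma model_ends_subset:
  assumes M: "topological_model R H \<phi> p q" and "d \<in> edges H"
  shows "ends H d \<subseteq> verts H"
  using assms(2) walk_edges_ends_subset[OF model_walk[OF M]]
  unfolding model_verts[OF M] model_edges[OF M] by blast

text \<open>The common surgery behind subdividing an edge (\<open>mid = []\<close>), suppressing a
  vertex (\<open>W = []\<close>) and taking a detour. It leaves the rest of the model intact because
  \<open>mid\<close> is interior to \<open>p e\<close>, so no other model path runs through it, and
  \<open>W\<close> is new.\<close>

lemma model_reroute:
  fixes R :: "('a, 'b) mgraph" and H :: "('v, 'e) mgraph"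
  assumes M: "topological_model R H \<phi> p q" and e: "e \<in> edges R"
    and p: "p e = pre @ y # mid @ y' # post" and q: "q e = q1 @ q2 @ q3"
    and w: "walk_edges H (pre @ [y]) q1" "walk_edges H (y # mid @ [y']) q2" "walk_edges H (y' # post) q3"
    and V: "verts H' = verts H - set mid \<union> set W"
    and Ed: "edges H' = edges H - set q2 \<union> set q2'"
    and ends: "\<And>d. d \<in> edges H - set q2 \<Longrightarrow> ends H' d = ends H d"
    and w': "walk_edges H' (y # W @ [y']) q2'"
    and W: "distinct W" "set W \<inter> verts H = {}" and q2': "distinct q2'" "set q2' \<inter> (edges H - set q2) = {}"
  shows "topological_model R H' \<phi> (p(e := pre @ y # W @ y' # post)) (q(e := q1 @ q2' @ q3))"
proof -
  have dq: "distinct (q e)" and dp: "distinct (p e)" using model_distinct[OF M e] by auto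
  have qE: "set (q d) \<subseteq> edges H" if "d \<in> edges R" for d using model_edges[OF M] that by auto
  have pV: "set (p d) \<subseteq> verts H" if "d \<in> edges R" for d using model_verts[OF M] that by auto
  have V\<phi>: "\<phi> ` verts R \<subseteq> verts H" using model_verts[OF M] by auto
  have mid\<phi>: "set mid \<inter> \<phi> ` verts R = {}"
  proof -
    have "hd (p e) \<notin> set mid" "last (p e) \<notin> set mid" using dp p by (cases pre; cases post rule: rev_cases; auto)+
    then show ?thesis using model_branch[OF M e] p by auto
  qed
  have hl: "hd (pre @ y # W @ y' # post) = hd (p e)" "last (pre @ y # W @ y' # post) = last (p e)"
    by (auto simp: p hd_append)
  have Wp: "set W \<inter> set (p d) = {}" if "d \<in> edges R" for d using pV that W by auto
  \<comment> \<open>Two model paths meet only in branch vertices, and \<open>mid\<close> contains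
    none.\<close>
  have other: "set (p d) \<inter> set mid = {}" "set (q d) \<inter> set (q e) = {}" if "d \<in> edges R" "d \<noteq> e" for d
    using model_meet[OF M that(1) e that(2)] mid\<phi> p by auto
  have 1: "inj_on \<phi> (verts R)" by (rule model_inj[OF M])
  have 2: "walk_edges H' (pre @ y # W @ y' # post) (q1 @ q2' @ q3)"
  proof -
    have "set (q1 @ q3) \<subseteq> edges H - set q2" using qE[OF e] dq q by auto
    then have "walk_edges H' (pre @ [y]) q1 = walk_edges H (pre @ [y]) q1"
      "walk_edges H' (y' # post) q3 = walk_edges H (y' # post) q3"
      using ends by (auto intro!: walk_edges_cong)
    then have "walk_edges H' (pre @ [y]) q1" "walk_edges H' (y' # post) q3" using w(1,3) by auto
    then show ?thesis
      using w' walk_edges_length[of H' "y # W @ [y']" q2'] walk_edges_length[of H' "pre @ [y]" q1]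
        walk_edges_append[of "pre" q1 H' y "W @ y' # post" "q2' @ q3"]
        walk_edges_append[of "y # W" q2' H' y' post q3] by simp
  qed
  have 3: "walk_edges H' (p d) (q d)" if "d \<in> edges R" "d \<noteq> e" for d
  proof -
    have "set (q d) \<subseteq> edges H - set q2" using other(2)[OF that] qE that q by auto
    then have "walk_edges H' (p d) (q d) = walk_edges H (p d) (q d)"
      using ends by (intro walk_edges_cong) auto
    then show ?thesis using model_walk[OF M that(1)] by auto
  qed
  have 4: "distinct (pre @ y # W @ y' # post)" using dp p W Wp[OF e] by auto
  have 5: "distinct (q1 @ q2' @ q3)" using dq q q2' qE[OF e] by auto
  have 6: "set (pre @ y # W @ y' # post) \<inter> \<phi> ` verts R \<subseteq> {hd (p e), last (p e)}"
    using model_branch[OF M e] V\<phi> W p by auto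
  have 7: "set (pre @ y # W @ y' # post) \<inter> set (p d) \<subseteq> \<phi> ` verts R"
    "set (q1 @ q2' @ q3) \<inter> set (q d) = {}" if "d \<in> edges R" "d \<noteq> e" for d
  proof -
    have "set (p e) \<inter> set (p d) \<subseteq> \<phi> ` verts R" using model_meet(1)[OF M e that(1)] that by auto
    then show "set (pre @ y # W @ y' # post) \<inter> set (p d) \<subseteq> \<phi> ` verts R"
      using Wp[OF that(1)] p by auto
    show "set (q1 @ q2' @ q3) \<inter> set (q d) = {}"
      using other(2)[OF that] qE[OF that(1)] q2' q by auto
  qed
  have 8: "verts H' = \<phi> ` verts R \<union> (\<Union>d\<in>edges R. set ((p(e := pre @ y # W @ y' # post)) d))"
  proof -
    let ?U = "\<Union>d\<in>edges R - {e}. set (p d)"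
    have split: "(\<Union>d\<in>edges R. set (f d)) = set (f e) \<union> (\<Union>d\<in>edges R - {e}. set (f d))" for f :: "'b \<Rightarrow> 'v list"
      using e by auto
    have "verts H = \<phi> ` verts R \<union> (set (p e) \<union> ?U)" unfolding model_verts[OF M] split[of p] ..
    moreover have "?U \<inter> set mid = {}" using other by auto
    moreover have "set (p e) - set mid = set (pre @ y # y' # post)" using p dp by auto
    ultimately have "verts H - set mid = \<phi> ` verts R \<union> (set (pre @ y # y' # post) \<union> ?U)"
      using mid\<phi> by (simp only: Un_Diff Diff_triv Int_commute)
    then show ?thesis unfolding V split[of "p(e := pre @ y # W @ y' # post)"] by auto
  qed
  have 9: "edges H' = (\<Union>d\<in>edges R. set ((q(e := q1 @ q2' @ q3)) d))"
  proof -
    let ?U = "\<Union>d\<in>edges R - {e}. set (q d)"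
    have split: "(\<Union>d\<in>edges R. set (f d)) = set (f e) \<union> (\<Union>d\<in>edges R - {e}. set (f d))" for f :: "'b \<Rightarrow> 'e list"
      using e by auto
    have "edges H = set (q e) \<union> ?U" unfolding model_edges[OF M] split[of q] ..
    moreover have "?U \<inter> set q2 = {}" using other q by auto
    moreover have "set (q e) - set q2 = set (q1 @ q3)" using q dq by auto
    ultimately have "edges H - set q2 = set (q1 @ q3) \<union> ?U"
      by (simp only: Un_Diff Diff_triv Int_commute)
    then show ?thesis unfolding Ed split[of "q(e := q1 @ q2' @ q3)"] by auto
  qed
  have 10: "d \<noteq> d' \<Longrightarrow> d \<in> edges R \<Longrightarrow> d' \<in> edges R \<Longrightarrow>
      set (p d) \<inter> set (p d') \<subseteq> \<phi> ` verts R \<and> set (q d) \<inter> set (q d') = {}" for d d'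
    using model_meet[OF M] by auto
  have 11: "\<phi> ` ends R d = {hd (p d), last (p d)} \<and> distinct (p d) \<and> distinct (q d) \<and>
      set (p d) \<inter> \<phi> ` verts R \<subseteq> {hd (p d), last (p d)}" if "d \<in> edges R" for d
    using model_ends[OF M that] model_distinct[OF M that] model_branch[OF M that] by auto
  show ?thesis
    unfolding topological_model_def
  proof (intro conjI ballI impI)
    show "verts H' = \<phi> ` verts R \<union> (\<Union>d\<in>edges R. set ((p(e := pre @ y # W @ y' # post)) d))" by (rule 8)
    show "edges H' = (\<Union>d\<in>edges R. set ((q(e := q1 @ q2' @ q3)) d))" by (rule 9)
    show "inj_on \<phi> (verts R)" by (rule 1)
  next
    fix d assume d: "d \<in> edges R"
    let ?p = "(p(e := pre @ y # W @ y' # post)) d" and ?q = "(q(e := q1 @ q2' @ q3)) d"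
    show "walk_edges H' ?p ?q" using 2 3[OF d] by simp
    show "distinct ?p" using 4 11[OF d] by auto
    show "distinct ?q" using 5 11[OF d] by auto
    show "\<phi> ` ends R d = {hd ?p, last ?p}" using 11[OF d] hl by auto
    show "set ?p \<inter> \<phi> ` verts R \<subseteq> {hd ?p, last ?p}" using 6 11[OF d] hl by (cases "d = e") (simp_all only: fun_upd_same fun_upd_other not_False_eq_True)
  next
    fix d d' assume d: "d \<in> edges R" "d' \<in> edges R" "d \<noteq> d'"
    let ?p = "p(e := pre @ y # W @ y' # post)" and ?q = "q(e := q1 @ q2' @ q3)"
    show "set (?p d) \<inter> set (?p d') \<subseteq> \<phi> ` verts R"
      using 7(1)[of d] 7(1)[of d'] 10[of d d'] d by (cases "d = e"; cases "d' = e") (auto simp only: fun_upd_same fun_upd_other not_False_eq_True)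
    show "set (?q d) \<inter> set (?q d') = {}"
      using 7(2)[of d] 7(2)[of d'] 10[of d d'] d by (cases "d = e"; cases "d' = e") (auto simp only: fun_upd_same fun_upd_other not_False_eq_True)
  qed
qed

section \<open>Subdivisions and topological models determine each other\<close>

lemma isomorphic_sym:
  assumes "isomorphic G H" and sub: "\<And>e. e \<in> edges G \<Longrightarrow> ends G e \<subseteq> verts G"
  shows "isomorphic H G"
proof -
  obtain f g where f: "bij_betw f (verts G) (verts H)" and g: "bij_betw g (edges G) (edges H)"
    and fg: "\<forall>e\<in>edges G. ends H (g e) = f ` ends G e"
    using assms(1) by (auto simp: isomorphic_def)
  let ?f = "inv_into (verts G) f" and ?g = "inv_into (edges G) g"
  have "ends G (?g d) = ?f ` ends H d" if "d \<in> edges H" for d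
  proof -
    have d: "?g d \<in> edges G" "g (?g d) = d"
      using g that by (auto simp: bij_betw_def inv_into_into f_inv_into_f)
    then have "ends H d = f ` ends G (?g d)" using fg by metis
    then show ?thesis
      using sub[OF d(1)] f inv_into_image_cancel[of f "verts G"] by (auto simp: bij_betw_def)
  qed
  then show ?thesis
    unfolding isomorphic_def using bij_betw_inv_into[OF f] bij_betw_inv_into[OF g] by blast
qed

text \<open>The starting model: each edge of \<open>R\<close> is a path of length one, its ends
  being listed in an arbitrary order.\<close>

lemma isomorphic_model:
  assumes "multigraph R" "isomorphic R R'"
  obtains \<phi> p q where "topological_model R R' \<phi> p q"
proof -
  obtain f g where f: "bij_betw f (verts R) (verts R')" and g: "bij_betw g (edges R) (edges R')"
    and fg: "\<forall>e\<in>edges R. ends R' (g e) = f ` ends R e"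
    using assms(2) by (auto simp: isomorphic_def)
  have "\<forall>e\<in>edges R. \<exists>a b. a \<noteq> b \<and> ends R e = {a, b}"
    using multigraph.card_ends[OF assms(1)] by (metis card_2_iff)
  then obtain a b where ab: "\<And>e. e \<in> edges R \<Longrightarrow> a e \<noteq> b e \<and> ends R e = {a e, b e}" by metis
  have V: "a e \<in> verts R" "b e \<in> verts R" if "e \<in> edges R" for e
    using multigraph.ends_in_verts[OF assms(1) that] ab[OF that] by auto
  have ne: "f (a e) \<noteq> f (b e)" if "e \<in> edges R" for e
    using f V[OF that] ab[OF that] by (auto simp: bij_betw_def inj_on_def)
  have "topological_model R R' f (\<lambda>e. [f (a e), f (b e)]) (\<lambda>e. [g e])"
    unfolding topological_model_def
  proof (intro conjI ballI impI)
    show "verts R' = f ` verts R \<union> (\<Union>e\<in>edges R. set [f (a e), f (b e)])"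
      using f V by (auto simp: bij_betw_def)
    show "edges R' = (\<Union>e\<in>edges R. set [g e])" using g by (auto simp: bij_betw_def)
    fix e e' assume "e \<in> edges R" "e' \<in> edges R" "e \<noteq> e'"
    then show "set [g e] \<inter> set [g e'] = {}" using g by (auto simp: bij_betw_def inj_on_def)
  qed (use f V ab ne fg in \<open>auto simp: bij_betw_def\<close>)
  then show ?thesis by (rule that)
qed

lemma walk_edges_map:
  assumes "walk_edges H vs es" "\<And>e. e \<in> set es \<Longrightarrow> ends H' (g e) = f ` ends H e"
  shows "walk_edges H' (map f vs) (map g es)"
  using assms by (induction H vs es rule: walk_edges.induct) auto

lemma model_isomorphic:
  assumes M: "topological_model R F \<phi> p q" and "isomorphic F H"
  obtains \<phi>' p' q' where "topological_model R H \<phi>' p' q'"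
proof -
  obtain f g where f: "inj_on f (verts F)" "f ` verts F = verts H"
    and g: "inj_on g (edges F)" "g ` edges F = edges H"
    and fg: "\<And>e. e \<in> edges F \<Longrightarrow> ends H (g e) = f ` ends F e"
    using assms(2) by (auto simp: isomorphic_def bij_betw_def)
  have V: "\<phi> ` verts R \<subseteq> verts F" "\<And>e. e \<in> edges R \<Longrightarrow> set (p e) \<subseteq> verts F"
    using model_verts[OF M] by auto
  have E: "\<And>e. e \<in> edges R \<Longrightarrow> set (q e) \<subseteq> edges F" using model_edges[OF M] by auto
  have ne: "p e \<noteq> []" if "e \<in> edges R" for e
    using model_walk[OF M that] walk_edges_not_Nil by blast
  have "topological_model R H (f \<circ> \<phi>) (\<lambda>e. map f (p e)) (\<lambda>e. map g (q e))"
    unfolding topological_model_def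
  proof (intro conjI ballI impI)
    show "inj_on (f \<circ> \<phi>) (verts R)"
      using comp_inj_on[OF model_inj[OF M]] f(1) V(1) inj_on_subset by blast
    show "verts H = (f \<circ> \<phi>) ` verts R \<union> (\<Union>e\<in>edges R. set (map f (p e)))"
      using f(2) unfolding model_verts[OF M] by (auto simp: image_Un image_UN image_comp)
    show "edges H = (\<Union>e\<in>edges R. set (map g (q e)))"
      using g(2) unfolding model_edges[OF M] by (auto simp: image_Un image_UN)
  next
    fix e assume e: "e \<in> edges R"
    show "walk_edges H (map f (p e)) (map g (q e))"
      using model_walk[OF M e] E[OF e] fg by (intro walk_edges_map) auto
    show "distinct (map f (p e))" "distinct (map g (q e))"
      using model_distinct[OF M e] V(2)[OF e] E[OF e] f(1) g(1)
      by (auto simp: distinct_map intro: inj_on_subset)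
    have "(f \<circ> \<phi>) ` ends R e = f ` {hd (p e), last (p e)}"
      using model_ends[OF M e] by (metis image_comp)
    then show "(f \<circ> \<phi>) ` ends R e = {hd (map f (p e)), last (map f (p e))}"
      using ne[OF e] by (simp add: hd_map last_map)
    have "set (map f (p e)) \<inter> (f \<circ> \<phi>) ` verts R = f ` (set (p e) \<inter> \<phi> ` verts R)"
      using inj_on_image_Int[OF f(1) V(2)[OF e] V(1)] by (simp add: image_comp)
    also have "\<dots> \<subseteq> f ` {hd (p e), last (p e)}" using model_branch[OF M e] by (rule image_mono)
    finally show "set (map f (p e)) \<inter> (f \<circ> \<phi>) ` verts R \<subseteq> {hd (map f (p e)), last (map f (p e))}"
      using ne[OF e] by (simp add: hd_map last_map)
  next
    fix e e' assume e: "e \<in> edges R" "e' \<in> edges R" "e \<noteq> e'"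
    have "set (map f (p e)) \<inter> set (map f (p e')) = f ` (set (p e) \<inter> set (p e'))"
      using inj_on_image_Int[OF f(1) V(2)[OF e(1)] V(2)[OF e(2)]] by simp
    also have "\<dots> \<subseteq> f ` \<phi> ` verts R" using model_meet(1)[OF M e] by (rule image_mono)
    finally show "set (map f (p e)) \<inter> set (map f (p e')) \<subseteq> (f \<circ> \<phi>) ` verts R"
      by (simp add: image_comp)
    have "set (map g (q e)) \<inter> set (map g (q e')) = g ` (set (q e) \<inter> set (q e'))"
      using inj_on_image_Int[OF g(1) E[OF e(1)] E[OF e(2)]] by simp
    then show "set (map g (q e)) \<inter> set (map g (q e')) = {}" using model_meet(2)[OF M e] by simp
  qed
  then show ?thesis by (rule that)
qed

lemma model_subdivide:
  assumes M: "topological_model R F \<phi> p q" and "subdivide_edge F F'"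
  obtains p' q' where "topological_model R F' \<phi> p' q'"
proof -
  obtain d u v w e1 e2 where d: "d \<in> edges F" "ends F d = {u, v}" and w: "w \<notin> verts F"
    and new: "e1 \<notin> edges F" "e2 \<notin> edges F" "e1 \<noteq> e2"
    and V: "verts F' = insert w (verts F)" and Ed: "edges F' = insert e1 (insert e2 (edges F - {d}))"
    and ends: "ends F' e1 = {u, w}" "ends F' e2 = {w, v}" "\<forall>d'\<in>edges F - {d}. ends F' d' = ends F d'"
    using assms(2) unfolding subdivide_edge_def by (elim exE conjE) (rule that; assumption)
  obtain e where e: "e \<in> edges R" "d \<in> set (q e)" using d model_edges[OF M] by auto
  then obtain q1 q3 where q: "q e = q1 @ d # q3" by (meson split_list)
  obtain pre y y' post where p: "p e = pre @ y # y' # post" "walk_edges F (pre @ [y]) q1"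
    "ends F d = {y, y'}" "walk_edges F (y' # post) q3"
    using walk_edges_split_edge[of F "p e" q1 d q3] model_walk[OF M e(1)] q by metis
  \<comment> \<open>\<open>p e\<close> may run through \<open>d\<close> in either direction, which
    decides the order of the two new edges.\<close>
  have "\<exists>es. set es = {e1, e2} \<and> distinct es \<and> walk_edges F' (y # [w] @ [y']) es"
  proof (cases "u = y")
    case True
    then have "v = y'" using d p(3) by (auto simp: doubleton_eq_iff)
    with True ends new show ?thesis by (intro exI[of _ "[e1, e2]"]) auto
  next
    case False
    then have "u = y'" "v = y" using d p(3) by (auto simp: doubleton_eq_iff)
    with ends new show ?thesis by (intro exI[of _ "[e2, e1]"]) auto
  qed
  then obtain es where es: "set es = {e1, e2}" "distinct es" "walk_edges F' (y # [w] @ [y']) es"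
    by blast
  have "topological_model R F' \<phi> (p(e := pre @ y # [w] @ y' # post)) (q(e := q1 @ es @ q3))"
    by (rule model_reroute[OF M e(1), of pre y "[]" y' post q1 "[d]" q3])
       (use p q V Ed w ends es new in auto)
  then show ?thesis by (rule that)
qed

lemma model_subdivisions:
  assumes "subdivide_edge\<^sup>*\<^sup>* F F'" "topological_model R F \<phi> p q"
  shows "\<exists>p' q'. topological_model R F' \<phi> p' q'"
  using assms
proof (induction rule: rtranclp_induct)
  case (step F1 F2)
  then show ?case using model_subdivide by blast
qed blast

lemma subdivision_imp_model:
  assumes "multigraph R" "is_subdivision_in R G H"
  obtains \<phi> p q where "topological_model R H \<phi> p q"
proof -
  obtain R' F :: "(nat, nat) mgraph"
    where iso: "isomorphic R R'" "subdivide_edge\<^sup>*\<^sup>* R' F" "isomorphic F H"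
    using assms(2) by (auto simp: is_subdivision_in_def)
  obtain \<phi> p q where "topological_model R R' \<phi> p q" using isomorphic_model[OF assms(1) iso(1)] .
  then obtain p' q' where "topological_model R F \<phi> p' q'" using model_subdivisions[OF iso(2)] by blast
  then show ?thesis using model_isomorphic[OF _ iso(3)] that by blast
qed

lemma model_finite:
  assumes "multigraph R" and M: "topological_model R H \<phi> p q"
  shows "finite (verts H)" "finite (edges H)"
  using assms(1) unfolding model_verts[OF M] model_edges[OF M] multigraph_def by auto

text \<open>The base case for undoing subdivisions. As \<open>R\<close> has no loops and \<phi> is
  injective, no \<open>p e\<close> is a single vertex, so each \<open>p e\<close> is exactly one
  edge.\<close>

lemma model_trivial_isomorphic:
  assumes "multigraph R" and M: "topological_model R H \<phi> p q"
    and len: "\<And>e. e \<in> edges R \<Longrightarrow> length (p e) \<le> 2"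
  shows "isomorphic R H"
proof -
  have "\<exists>a b. p e = [a, b] \<and> q e = [hd (q e)] \<and> ends H (hd (q e)) = {a, b}" if e: "e \<in> edges R" for e
  proof -
    have "\<exists>x y. x \<in> verts R \<and> y \<in> verts R \<and> x \<noteq> y \<and> ends R e = {x, y}"
      using multigraph.card_ends[OF assms(1) e] multigraph.ends_in_verts[OF assms(1) e]
      by (auto simp: card_2_iff)
    then have "hd (p e) \<noteq> last (p e)"
      using model_ends[OF M e] model_inj[OF M] by (auto simp: inj_on_def doubleton_eq_iff)
    then obtain a b where "p e = [a, b]"
      using len[OF e] walk_edges_not_Nil[OF model_walk[OF M e]]
      by (cases "p e"; cases "tl (p e)"; cases "tl (tl (p e))") auto
    moreover from this model_walk[OF M e] have "q e = [hd (q e)] \<and> ends H (hd (q e)) = {a, b}"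
      by (cases "q e"; cases "tl (q e)") auto
    ultimately show ?thesis by auto
  qed
  then obtain a b where ab: "\<And>e. e \<in> edges R \<Longrightarrow> p e = [a e, b e]"
    "\<And>e. e \<in> edges R \<Longrightarrow> q e = [hd (q e)]" "\<And>e. e \<in> edges R \<Longrightarrow> ends H (hd (q e)) = {a e, b e}"
    by metis
  have ends: "\<phi> ` ends R e = {a e, b e}" if "e \<in> edges R" for e
    using model_ends[OF M that] ab(1)[OF that] by simp
  have sq: "set (q e) = {hd (q e)}" if "e \<in> edges R" for e
    using ab(2)[OF that] by (metis empty_set list.simps(15))
  have "verts H = \<phi> ` verts R"
  proof -
    have "set (p e) \<subseteq> \<phi> ` verts R" if "e \<in> edges R" for e
    proof -
      have "set (p e) = \<phi> ` ends R e" using ends[OF that] ab(1)[OF that] by simp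
      then show ?thesis using multigraph.ends_in_verts[OF assms(1) that] by auto
    qed
    then show ?thesis using model_verts[OF M] by auto
  qed
  then have 1: "bij_betw \<phi> (verts R) (verts H)" using model_inj[OF M] by (simp add: bij_betw_def)
  have 2: "bij_betw (\<lambda>e. hd (q e)) (edges R) (edges H)"
    unfolding bij_betw_def
  proof
    show "inj_on (\<lambda>e. hd (q e)) (edges R)"
    proof (rule inj_onI, rule ccontr)
      fix e e' assume "e \<in> edges R" "e' \<in> edges R" "hd (q e) = hd (q e')" "e \<noteq> e'"
      then show False using model_meet(2)[OF M, of e e'] sq by auto
    qed
    show "(\<lambda>e. hd (q e)) ` edges R = edges H" using model_edges[OF M] sq by auto
  qed
  show ?thesis
    unfolding isomorphic_def using 1 2 ab(3) ends by (intro exI[of _ \<phi>] exI[of _ "\<lambda>e. hd (q e)"]) auto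
qed

text \<open>Suppressing an interior vertex of a model path is the inverse of a subdivision. The new
  edge needs a fresh name, hence the natural numbers.\<close>

lemma model_imp_subdivisions:
  fixes H :: "(nat, nat) mgraph"
  assumes "multigraph R" "topological_model R H \<phi> p q"
  shows "\<exists>R' :: (nat, nat) mgraph. isomorphic R R' \<and> subdivide_edge\<^sup>*\<^sup>* R' H"
  using assms(2)
proof (induction "card (verts H)" arbitrary: H p q rule: less_induct)
  case less
  note M = less.prems
  show ?case
  proof (cases "\<forall>e\<in>edges R. length (p e) \<le> 2")
    case True
    then show ?thesis using model_trivial_isomorphic[OF assms(1) M] by blast
  next
    case False
    then obtain e where e: "e \<in> edges R" "length (p e) > 2" by force
    then obtain y w y' post where p: "p e = y # w # y' # post"
      by (cases "p e"; cases "tl (p e)"; cases "tl (tl (p e))") auto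
    with model_walk[OF M e(1)] obtain e1 e2 q3 where q: "q e = e1 # e2 # q3"
      and ends: "ends H e1 = {y, w}" "ends H e2 = {w, y'}" "walk_edges H (y' # post) q3"
      by (cases "q e"; cases "tl (q e)") auto
    obtain e0 where e0: "e0 \<notin> edges H" using ex_new_if_finite model_finite(2)[OF assms(1) M] infinite_UNIV_nat by blast
    define H0 where "H0 = \<lparr>verts = verts H - {w}, edges = insert e0 (edges H - {e1, e2}),
      ends = (ends H)(e0 := {y, y'})\<rparr>"
    have mem: "w \<in> verts H" "e1 \<in> edges H" "e2 \<in> edges H" "e1 \<noteq> e2"
      using e p q model_verts[OF M] model_edges[OF M] model_distinct[OF M e(1)] by fastforce+
    \<comment> \<open>\<open>w\<close> is interior to \<open>p e\<close>; rerouting with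
      \<open>mid = [w]\<close> and \<open>W = []\<close> suppresses it.\<close>
    have "topological_model R H0 \<phi> (p(e := [] @ y # [] @ y' # post)) (q(e := [] @ [e0] @ q3))"
      by (rule model_reroute[OF M e(1), of "[]" y "[w]" y' post "[]" "[e1, e2]" q3])
         (use p q ends e0 mem in \<open>auto simp: H0_def\<close>)
    moreover have "card (verts H0) < card (verts H)"
      using card_Diff1_less[OF model_finite(1)[OF assms(1) M] mem(1)] by (simp add: H0_def)
    ultimately obtain R' :: "(nat, nat) mgraph" where R': "isomorphic R R'" "subdivide_edge\<^sup>*\<^sup>* R' H0"
      using less.hyps by blast
    have "subdivide_edge H0 H"
      unfolding subdivide_edge_def
      by (rule exI[of _ e0], rule exI[of _ y], rule exI[of _ y'], rule exI[of _ w],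
          rule exI[of _ e1], rule exI[of _ e2]) (use mem ends e0 in \<open>auto simp: H0_def\<close>)
    with R' show ?thesis by (meson rtranclp.rtrancl_into_rtrancl)
  qed
qed

text \<open>\<open>H\<close> is first copied to natural numbers, where fresh names are available,
  and the result is carried back along the inverse isomorphism.\<close>

lemma model_imp_subdivision:
  assumes R: "multigraph R" and M: "topological_model R H \<phi> p q" and "subgraph_of H G"
  shows "is_subdivision_in R G H"
proof -
  obtain f :: "_ \<Rightarrow> nat" where f: "inj_on f (verts H)"
    using finite_imp_inj_to_nat_seg model_finite(1)[OF R M] by metis
  obtain g :: "_ \<Rightarrow> nat" where g: "inj_on g (edges H)"
    using finite_imp_inj_to_nat_seg model_finite(2)[OF R M] by metis
  define N where "N = \<lparr>verts = f ` verts H, edges = g ` edges H,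
    ends = (\<lambda>k. f ` ends H (inv_into (edges H) g k))\<rparr>"
  have N: "isomorphic H N"
    unfolding isomorphic_def N_def using f g by (intro exI[of _ f] exI[of _ g]) (auto simp: bij_betw_def)
  then have "isomorphic N H" using isomorphic_sym model_ends_subset[OF M] by blast
  moreover obtain \<phi>' p' q' where "topological_model R N \<phi>' p' q'" using model_isomorphic[OF M N] .
  ultimately show ?thesis
    using model_imp_subdivisions[OF R] assms(3) unfolding is_subdivision_in_def by blast
qed

section \<open>Connectivity of subdivisions and detours\<close>

definition connected_in :: "('v \<times> 'v) set \<Rightarrow> 'v set \<Rightarrow> bool" where
  "connected_in E F \<longleftrightarrow>
     (\<forall>u\<in>F. \<forall>v\<in>F. \<exists>p. is_path E p \<and> hd p = u \<and> last p = v \<and> set p \<subseteq> F)"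

text \<open>This is the form in which maximality enters the hitting argument. It speaks of vertex
  lists and the vertex set \<open>F\<close> of the whole subdivision only, so that no models are
  needed there.\<close>

definition detour_free :: "('v \<times> 'v) set \<Rightarrow> 'v set \<Rightarrow> 'v list \<Rightarrow> bool" where
  "detour_free E F p \<longleftrightarrow> (\<forall>pre y mid y' post W.
     p = pre @ y # mid @ y' # post \<and> W \<noteq> [] \<and> is_path E (y # W @ [y']) \<and> set W \<inter> F = {}
     \<longrightarrow> length W \<le> length mid)"

lemma sym_adj_rel: "sym (adj_rel G)"
  by (auto simp: sym_def adj_rel_def insert_commute)

lemma adj_rel_subset: "multigraph G \<Longrightarrow> adj_rel G \<subseteq> verts G \<times> verts G"
  by (auto simp: adj_rel_def dest: multigraph.ends_in_verts)

lemma walk_subset: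
  "successively (\<lambda>u v. (u, v) \<in> E) p \<Longrightarrow> E \<subseteq> V \<times> V \<Longrightarrow> p \<noteq> [] \<Longrightarrow> hd p \<in> V \<Longrightarrow> set p \<subseteq> V"
  by (induction p rule: induct_list012) auto

lemma rtrancl_imp_path:
  assumes "(u, v) \<in> (E \<inter> F \<times> F)\<^sup>*" "u \<in> F"
  shows "\<exists>p. is_path E p \<and> hd p = u \<and> last p = v \<and> set p \<subseteq> F"
proof -
  have "\<exists>p. p \<noteq> [] \<and> successively (\<lambda>u v. (u, v) \<in> E) p \<and> hd p = u \<and> last p = v \<and> set p \<subseteq> F"
    using assms
  proof (induction rule: rtrancl_induct)
    case base
    then show ?case by (intro exI[of _ "[u]"]) auto
  next
    case (step v w)
    then obtain p where "p \<noteq> []" "successively (\<lambda>u v. (u, v) \<in> E) p" "hd p = u" "last p = v" "set p \<subseteq> F"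
      by auto
    with step show ?case by (intro exI[of _ "p @ [w]"]) (auto simp: successively_append_iff)
  qed
  then show ?thesis using walk_imp_path by (metis order_trans)
qed

lemma walk_imp_rtrancl:
  assumes "successively (\<lambda>u v. (u, v) \<in> E) p" "sym E" "x \<in> set p" "y \<in> set p"
  shows "(x, y) \<in> E\<^sup>*"
proof -
  have hd: "z \<in> set p \<Longrightarrow> (hd p, z) \<in> E\<^sup>*" for z
    using assms(1) by (induction p rule: induct_list012) (auto intro: converse_rtrancl_into_rtrancl)
  have "(x, hd p) \<in> E\<^sup>*" using symD[OF sym_rtrancl[OF assms(2)] hd[OF assms(3)]] .
  then show ?thesis using hd[OF assms(4)] by (rule rtrancl_trans)
qed

text \<open>A walk from \<open>a\<close> to an end of some edge starts with an edge at
  \<open>a\<close>, unless \<open>a\<close> is that end itself.\<close>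

lemma connected_incident_edge:
  assumes "multigraph R" "connected_mgraph R" "edges R \<noteq> {}" "a \<in> verts R"
  shows "\<exists>e\<in>edges R. a \<in> ends R e"
proof -
  obtain e0 x y where e0: "e0 \<in> edges R" "ends R e0 = {x, y}" "x \<noteq> y"
    using assms(1,3) multigraph.card_ends by (metis all_not_in_conv card_2_iff)
  then have xy: "x \<in> verts R" "y \<in> verts R" using multigraph.ends_in_verts[OF assms(1)] by auto
  show ?thesis
  proof (cases "a = x")
    case False
    have "(a, x) \<in> (adj_rel R)\<^sup>*" using assms(2,4) xy by (auto simp: connected_mgraph_def)
    with False obtain b where "(a, b) \<in> adj_rel R" by (meson converse_rtranclE)
    then show ?thesis by (auto simp: adj_rel_def)
  qed (use e0 in auto)
qed

lemma model_path:
  assumes M: "topological_model R H \<phi> p q" and "subgraph_of H G" and e: "e \<in> edges R"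
  shows "is_path (adj_rel G) (p e)"
proof -
  have "set (q e) \<subseteq> edges H" using model_edges[OF M] e by auto
  then have "successively (\<lambda>u v. (u, v) \<in> adj_rel G) (p e)"
    using assms(2) by (intro walk_edges_successively[OF model_walk[OF M e]]) (auto simp: subgraph_of_def)
  then show ?thesis
    using model_distinct(1)[OF M e] walk_edges_not_Nil[OF model_walk[OF M e]] by (auto simp: is_path_def)
qed

text \<open>No vertex of \<open>R\<close> is isolated, so every branch vertex is an end of a model
  path. Thus \<open>m\<close> paths cover the whole subdivision.\<close>

lemma model_verts_connected:
  assumes "multigraph R" "connected_mgraph R" "edges R \<noteq> {}" and M: "topological_model R H \<phi> p q"
  shows "verts H = (\<Union>e\<in>edges R. set (p e))"
proof -
  have "\<phi> a \<in> (\<Union>e\<in>edges R. set (p e))" if a: "a \<in> verts R" for a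
  proof -
    obtain e where e: "e \<in> edges R" "a \<in> ends R e" using connected_incident_edge[OF assms(1-3) a] by blast
    then have "\<phi> a \<in> {hd (p e), last (p e)}" using model_ends[OF M e(1)] by blast
    moreover have "p e \<noteq> []" using walk_edges_not_Nil[OF model_walk[OF M e(1)]] .
    ultimately have "\<phi> a \<in> set (p e)" by auto
    then show ?thesis using e by blast
  qed
  then show ?thesis using model_verts[OF M] by auto
qed

text \<open>Every vertex reaches a branch vertex along its model path, and walks in \<open>R\<close>
  lift to walks between branch vertices.\<close>

lemma subdivision_connected:
  assumes R: "multigraph R" "connected_mgraph R" "edges R \<noteq> {}"
    and M: "topological_model R H \<phi> p q" and H: "subgraph_of H G"
  shows "connected_in (adj_rel G) (verts H)"
proof -
  \<comment> \<open>Restricting the adjacency to \<open>H\<close> keeps all walks inside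
    \<open>verts H\<close>.\<close>
  define E where "E = adj_rel G \<inter> verts H \<times> verts H"
  have "sym E" using sym_adj_rel by (fastforce simp: E_def sym_def)
  have V: "set (p e) \<subseteq> verts H" if "e \<in> edges R" for e using model_verts[OF M] that by auto
  have pE: "(x, y) \<in> E\<^sup>*" if "e \<in> edges R" "x \<in> set (p e)" "y \<in> set (p e)" for e x y
  proof (rule walk_imp_rtrancl[OF _ \<open>sym E\<close> that(2,3)])
    show "successively (\<lambda>u v. (u, v) \<in> E) (p e)"
      using model_path[OF M H that(1)] V[OF that(1)]
      by (auto simp: E_def is_path_def elim!: successively_mono)
  qed
  have ends: "\<phi> ` ends R e = {hd (p e), last (p e)}" "hd (p e) \<in> set (p e)" "last (p e) \<in> set (p e)"
    if "e \<in> edges R" for e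
    using model_ends[OF M that] walk_edges_not_Nil[OF model_walk[OF M that]] by auto
  have \<phi>: "(\<phi> a, \<phi> b) \<in> E\<^sup>*" if "(a, b) \<in> (adj_rel R)\<^sup>*" for a b
    using that
  proof (induction rule: rtrancl_induct)
    case (step b c)
    then obtain e where e: "e \<in> edges R" "ends R e = {b, c}" by (auto simp: adj_rel_def)
    then have "\<phi> b \<in> set (p e)" "\<phi> c \<in> set (p e)"
      using ends[OF e(1)] by (auto simp: doubleton_eq_iff)
    then show ?case using step pE[OF e(1)] by (meson rtrancl_trans)
  qed auto
  have near: "\<exists>a\<in>verts R. (\<phi> a, x) \<in> E\<^sup>* \<and> (x, \<phi> a) \<in> E\<^sup>*" if x: "x \<in> verts H" for x
  proof -
    obtain e where e: "e \<in> edges R" "x \<in> set (p e)" using x model_verts_connected[OF R M] by auto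
    obtain a where a: "a \<in> ends R e" "\<phi> a = hd (p e)" using ends(1)[OF e(1)] by (metis imageE insertI1)
    have "(\<phi> a, x) \<in> E\<^sup>* \<and> (x, \<phi> a) \<in> E\<^sup>*"
      unfolding a(2) using pE[OF e(1)] e(2) ends(2)[OF e(1)] by blast
    then show ?thesis using multigraph.ends_in_verts[OF R(1) e(1)] a(1) by blast
  qed
  have "(u, v) \<in> E\<^sup>*" if uv: "u \<in> verts H" "v \<in> verts H" for u v
  proof -
    obtain a b where "a \<in> verts R" "b \<in> verts R" "(u, \<phi> a) \<in> E\<^sup>*" "(\<phi> b, v) \<in> E\<^sup>*"
      using near uv by meson
    moreover from this have "(\<phi> a, \<phi> b) \<in> E\<^sup>*" using R(2) \<phi> by (auto simp: connected_mgraph_def)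
    ultimately show ?thesis by (meson rtrancl_trans)
  qed
  then show ?thesis unfolding connected_in_def E_def using rtrancl_imp_path by metis
qed

text \<open>Since \<open>W\<close> is nonempty, no edge of the walk leads directly from
  \<open>y\<close> to \<open>y'\<close>. This makes the edges of a detour new.\<close>

lemma walk_edges_meet_interior:
  assumes "walk_edges H (y # W @ [y']) es" "W \<noteq> []" "d \<in> set es"
  shows "ends H d \<inter> set W \<noteq> {}"
proof -
  obtain es1 es2 where "es = es1 @ d # es2" using assms(3) by (meson split_list)
  then obtain xs a b zs where x: "y # W @ [y'] = xs @ a # b # zs" "ends H d = {a, b}"
    using walk_edges_split_edge[of H "y # W @ [y']" es1 d es2] assms(1) by metis
  show ?thesis
  proof (cases xs)
    case Nil
    then show ?thesis using x assms(2) by (cases W) auto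
  next
    case (Cons c xs')
    then have "W = butlast (xs' @ a # b # zs)" using x by (metis append_Cons butlast_snoc list.inject)
    then show ?thesis using x by (auto simp: butlast_append)
  qed
qed

text \<open>Exchanging \<open>mid\<close> for \<open>W\<close> yields another subdivision of
  \<open>R\<close> in \<open>G\<close>, whose number of vertices differs by
  \<open>length W - length mid\<close>; maximality makes this difference at most
  \<open>0\<close>.\<close>

lemma max_subdivision_detour_free:
  assumes R: "multigraph R" and G: "multigraph G" and H: "is_max_subdivision_in R G H"
    and M: "topological_model R H \<phi> p q" and e: "e \<in> edges R"
  shows "detour_free (adj_rel G) (verts H) (p e)"
  unfolding detour_free_def
proof (intro allI impI, elim conjE)
  fix pre y mid y' post W
  assume p: "p e = pre @ y # mid @ y' # post" and W: "W \<noteq> []" "is_path (adj_rel G) (y # W @ [y'])"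
    "set W \<inter> verts H = {}"
  have sub: "subgraph_of H G" using H by (auto simp: is_max_subdivision_in_def is_subdivision_in_def)
  obtain q1 q' where q1: "q e = q1 @ q'" "walk_edges H (pre @ [y]) q1" "walk_edges H (y # mid @ y' # post) q'"
    using walk_edges_split[of H pre y "mid @ y' # post" "q e"] model_walk[OF M e] p by metis
  obtain q2 q3 where q2: "q' = q2 @ q3" "walk_edges H (y # mid @ [y']) q2" "walk_edges H (y' # post) q3"
    using walk_edges_split[of H "y # mid" y' post q'] q1(3) by auto
  obtain es where es: "walk_edges G (y # W @ [y']) es" "set es \<subseteq> edges G"
    using successively_walk_edges[of G "y # W @ [y']"] W(2) by (auto simp: is_path_def)
  have ends: "ends G d = ends H d" if "d \<in> edges H" for d using sub that by (auto simp: subgraph_of_def)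
  have new: "set es \<inter> edges H = {}"
    using walk_edges_meet_interior[OF es(1) W(1)] W(3) ends model_ends_subset[OF M] by blast
  \<comment> \<open>The ends are taken from \<open>G\<close>, which agrees with \<open>H\<close> on
    the old edges and also supplies those of the detour.\<close>
  define H' where "H' = \<lparr>verts = verts H - set mid \<union> set W, edges = edges H - set q2 \<union> set es, ends = ends G\<rparr>"
  have w': "walk_edges H' (y # W @ [y']) es"
    using es(1) walk_edges_cong[of es H' G] by (simp add: H'_def)
  have dW: "distinct (y # W @ [y'])" using W(2) by (simp add: is_path_def)
  have "topological_model R H' \<phi> (p(e := pre @ y # W @ y' # post)) (q(e := q1 @ es @ q3))"
    by (rule model_reroute[OF M e, of pre y mid y' post q1 q2 q3])
       (use p q1 q2 w' W new ends dW walk_edges_distinct[OF es(1)] in \<open>auto simp: H'_def\<close>)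
  then obtain p' q' where M': "topological_model R H' \<phi> p' q'" by blast
  have midV: "set mid \<subseteq> verts H" "y \<in> verts H" using model_verts[OF M] e p by fastforce+
  have "set (y # W @ [y']) \<subseteq> verts G"
    using W(2) midV(2) sub adj_rel_subset[OF G] unfolding is_path_def
    by (intro walk_subset[of "adj_rel G"]) (auto simp: subgraph_of_def)
  moreover have "multigraph H'"
  proof
    fix d assume d: "d \<in> edges H'"
    then have "d \<in> edges G" using sub es by (auto simp: H'_def subgraph_of_def)
    then show "card (ends H' d) = 2" using multigraph.card_ends[OF G] by (auto simp: H'_def)
    show "ends H' d \<subseteq> verts H'" using model_ends_subset[OF M' d] .
  qed (use model_finite[OF R M'] in auto)
  ultimately have "subgraph_of H' G" using sub es by (auto simp: H'_def subgraph_of_def)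
  then have "is_subdivision_in R G H'" using model_imp_subdivision[OF R M'] by blast
  then have "card (verts H') \<le> card (verts H)" using H by (auto simp: is_max_subdivision_in_def)
  moreover have "card (verts H') = card (verts H - set mid) + card (set W)"
    unfolding H'_def using W(3) model_finite(1)[OF R M] by (subst card_Un_disjoint[symmetric]) auto
  moreover have "card (verts H - set mid) = card (verts H) - length mid"
    using midV(1) model_distinct(1)[OF M e] p by (simp add: card_Diff_subset distinct_card)
  moreover have "card (set W) = length W" using dW by (simp add: distinct_card)
  ultimately show "length W \<le> length mid" by linarith
qed

section \<open>Hitting pairwise intersecting connected sets\<close>

lemma is_path_rev: "sym E \<Longrightarrow> is_path E p \<Longrightarrow> is_path E (rev p)"
  unfolding is_path_def by (auto simp: successively_rev dest: symD elim!: successively_mono)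

lemma is_path_glue:
  "is_path E (xs @ [z]) \<Longrightarrow> is_path E (z # ys) \<Longrightarrow> set xs \<inter> set ys = {} \<Longrightarrow> is_path E (xs @ z # ys)"
  unfolding is_path_def by (auto simp: successively_append_iff)

text \<open>Start at the last vertex in \<open>A\<close> and stop at the first vertex in
  \<open>B\<close> after it.\<close>

lemma path_trim:
  assumes p: "is_path E p" "hd p \<in> A" "last p \<in> B" and AB: "A \<inter> B = {}"
  shows "\<exists>x l y. is_path E (x # l @ [y]) \<and> x \<in> A \<and> y \<in> B \<and> set l \<inter> (A \<union> B) = {} \<and>
    set (x # l @ [y]) \<subseteq> set p"
proof -
  have "p \<noteq> []" using p by (auto simp: is_path_def)
  then have "\<exists>x\<in>set p. x \<in> A" using p(2) by auto
  then obtain ys x zs where s: "p = ys @ x # zs" "x \<in> A" "\<forall>z\<in>set zs. z \<notin> A"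
    using split_list_last_prop[of p "\<lambda>v. v \<in> A"] by blast
  have "zs \<noteq> [] \<and> last zs \<in> B" using p(3) s AB by (auto split: if_splits)
  then have "\<exists>y\<in>set zs. y \<in> B" by auto
  then obtain l y rest where l: "zs = l @ y # rest" "y \<in> B" "\<forall>z\<in>set l. z \<notin> B"
    using split_list_first_prop[of zs "\<lambda>v. v \<in> B"] by blast
  have "is_path E (x # l @ [y])"
    using p(1) unfolding s(1) l(1) is_path_def
    by (auto simp: successively_append_iff successively_Cons hd_append)
  then show ?thesis using s l by (intro exI[of _ x] exI[of _ l] exI[of _ y]) auto
qed

text \<open>The two arcs between \<open>x\<close> and \<open>y\<close> together cover
  \<open>c\<close>, so one of them has at least half of its vertices. The second arc runs through
  the closing edge and is reversed to start at \<open>x\<close>.\<close>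

lemma cycle_arc_ordered:
  assumes c: "distinct c" "successively (\<lambda>u v. (u, v) \<in> E) c" "(last c, hd c) \<in> E" and E: "sym E"
    and s: "c = a @ x # b @ y # d"
  shows "\<exists>Z. is_path E Z \<and> hd Z = x \<and> last Z = y \<and> set Z \<subseteq> set c \<and> length c \<le> 2 * length Z"
proof -
  let ?Z1 = "x # b @ [y]" and ?Z2 = "(y # d) @ (a @ [x])"
  have 1: "is_path E ?Z1"
    using c(1,2) unfolding s is_path_def by (auto simp: successively_append_iff successively_Cons hd_append)
  have "successively (\<lambda>u v. (u, v) \<in> E) (y # d)"
    using c(2) unfolding s by (auto simp: successively_append_iff successively_Cons)
  moreover have "successively (\<lambda>u v. (u, v) \<in> E) (a @ [x])"
    using c(2) unfolding s by (auto simp: successively_append_iff successively_Cons)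
  moreover have "(last (y # d), hd (a @ [x])) \<in> E" using c(3) unfolding s by (cases a; cases d) auto
  ultimately have "successively (\<lambda>u v. (u, v) \<in> E) ?Z2"
    by (subst successively_append_iff) auto
  then have "is_path E ?Z2" using c(1) unfolding s is_path_def by auto
  then have 2: "is_path E (rev ?Z2)" using is_path_rev[OF E] by blast
  have "length c \<le> 2 * length ?Z1 \<or> length c \<le> 2 * length ?Z2" unfolding s by auto
  then show ?thesis
  proof
    assume "length c \<le> 2 * length ?Z1"
    then show ?thesis using 1 unfolding s by (intro exI[of _ ?Z1]) auto
  next
    assume "length c \<le> 2 * length ?Z2"
    then show ?thesis using 2 unfolding s by (intro exI[of _ "rev ?Z2"]) auto
  qed
qed

lemma cycle_arc:
  assumes c: "distinct c" "successively (\<lambda>u v. (u, v) \<in> E) c" "(last c, hd c) \<in> E" and E: "sym E"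
    and xy: "x \<in> set c" "y \<in> set c" "x \<noteq> y"
  shows "\<exists>Z. is_path E Z \<and> hd Z = x \<and> last Z = y \<and> set Z \<subseteq> set c \<and> length c \<le> 2 * length Z"
proof -
  obtain a e where a: "c = a @ x # e" using xy(1) by (meson split_list)
  show ?thesis
  proof (cases "y \<in> set e")
    case True
    then obtain b d where "e = b @ y # d" by (meson split_list)
    with a show ?thesis using cycle_arc_ordered[OF c E, of a x b y d] by simp
  next
    case False
    then have "y \<in> set a" using xy a by auto
    then obtain a' b where "a = a' @ y # b" by (meson split_list)
    with a obtain Z where Z: "is_path E Z" "hd Z = y" "last Z = x" "set Z \<subseteq> set c" "length c \<le> 2 * length Z"
      using cycle_arc_ordered[OF c E, of a' y b x e] by auto
    then show ?thesis using is_path_rev[OF E Z(1)]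
      by (intro exI[of _ "rev Z"]) (auto simp: hd_rev last_rev)
  qed
qed

text \<open>Blocks of length \<open>d\<close>, which is \<open>c / 2\<close> rounded up, contain at
  most one element of \<open>I\<close> each. They are numbered from \<open>0\<close> to
  \<open>(N - 1) div d\<close>, whence the \<open>- 1\<close> in the bound.\<close>

lemma spread_card:
  fixes I :: "nat set"
  assumes I: "I \<subseteq> {..<N}" and gap: "\<And>i j. i \<in> I \<Longrightarrow> j \<in> I \<Longrightarrow> i < j \<Longrightarrow> c \<le> 2 * (j - i)"
  shows "(card I - 1) * c \<le> 2 * N"
proof (cases "c = 0 \<or> I = {}")
  case False
  define d where "d = (c + 1) div 2"
  have d: "d > 0" "c \<le> 2 * d" using False by (auto simp: d_def)
  have "inj_on (\<lambda>i. i div d) I"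
  proof (rule linorder_inj_onI)
    fix i j assume ij: "i < j" "i \<in> I" "j \<in> I"
    have "d \<le> j - i" using gap[OF ij(2,3,1)] by (auto simp: d_def)
    then have "i + d \<le> j" using ij by linarith
    then have "i div d + 1 \<le> j div d" using div_le_mono[of "i + d" j d] d by simp
    then show "i div d \<noteq> j div d" by linarith
  qed auto
  moreover have "(\<lambda>i. i div d) ` I \<subseteq> {..(N - 1) div d}"
    using I by (auto intro!: div_le_mono)
  ultimately have "card I \<le> card {..(N - 1) div d}" by (metis card_inj_on_le finite_atMost)
  then have "card I - 1 \<le> (N - 1) div d" by auto
  then have "(card I - 1) * d \<le> N - 1" by (meson div_times_less_eq_dividend le_trans mult_le_mono1)
  moreover have "(card I - 1) * c \<le> (card I - 1) * (2 * d)" using d by (intro mult_le_mono2)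
  ultimately show ?thesis by (simp add: algebra_simps)
qed auto

text \<open>A discrete intermediate value argument; it will find the jump of a path that passes over
  position \<open>j\<close>. The function need not be monotone.\<close>

lemma nat_intermediate_step:
  fixes f :: "nat \<Rightarrow> nat"
  assumes "f 0 \<le> j" "j < f n"
  shows "\<exists>k<n. f k \<le> j \<and> j \<le> f (Suc k)"
  using assms(2)
proof (induction n)
  case (Suc n)
  then show ?case by (cases "j < f n") (auto intro: less_SucI)
qed (use assms(1) in auto)

text \<open>Turns two consecutive visits to a set into a stretch of the list whose interior avoids
  that set.\<close>

lemma consecutive_in_filter:
  assumes "filter Q xs = as @ u # v # bs"
  shows "\<exists>xs1 ys xs2. xs = xs1 @ u # ys @ v # xs2 \<and> (\<forall>y\<in>set ys. \<not> Q y)"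
  using assms
proof (induction as arbitrary: xs)
  case Nil
  then obtain us vs where "xs = us @ u # vs" "filter Q vs = v # bs"
    by (metis append_Nil filter_eq_Cons_iff)
  then show ?case by (auto simp: filter_eq_Cons_iff)
next
  case (Cons a as)
  then obtain us vs where xs: "xs = us @ a # vs" "filter Q vs = as @ u # v # bs"
    by (metis append_Cons filter_eq_Cons_iff)
  obtain xs1 ys xs2 where "vs = xs1 @ u # ys @ v # xs2" "\<forall>y\<in>set ys. \<not> Q y"
    using Cons.IH[OF xs(2)] by blast
  with xs(1) show ?case by (intro exI[of _ "us @ a # xs1"] exI[of _ ys] exI[of _ xs2]) auto
qed

section \<open>Hitting numbers and linkages in a family of pairwise intersecting connected
  sets\<close>

locale linked_family =
  fixes V :: "'v set" and E :: "('v \<times> 'v) set" and \<F> :: "'v set set"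
  assumes finite_V: "finite V" and E_subset: "E \<subseteq> V \<times> V" and sym_E: "sym E"
    and member_subset: "F \<in> \<F> \<Longrightarrow> F \<subseteq> V"
    and connected: "F \<in> \<F> \<Longrightarrow> connected_in E F"
    and intersecting: "F \<in> \<F> \<Longrightarrow> F' \<in> \<F> \<Longrightarrow> F \<inter> F' \<noteq> {}"
begin

definition hits :: "'v set \<Rightarrow> 'v set \<Rightarrow> bool" where
  "hits X S \<longleftrightarrow> S \<subseteq> V \<and> (\<forall>F\<in>\<F>. F \<inter> X \<noteq> {} \<longrightarrow> F \<inter> S \<noteq> {})"

text \<open>For \<open>X = V\<close> this is the least size of a set meeting every member, since
  \<open>intersecting\<close> makes members nonempty. The hitting set may use vertices outside
  \<open>X\<close>. Being monotone, subadditive and at most \<open>card X\<close>, \<open>nu\<close>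
  measures how hard \<open>X\<close> is to cut off from the family.\<close>

definition nu :: "'v set \<Rightarrow> nat" where
  "nu X = (LEAST k. \<exists>S. hits X S \<and> card S = k)"

lemma nu_le: "hits X S \<Longrightarrow> nu X \<le> card S"
  unfolding nu_def by (rule Least_le) blast

lemma hits_self: "hits X (X \<inter> V)"
  unfolding hits_def using member_subset by blast

lemma nu_attained: obtains S where "hits X S" "card S = nu X"
proof -
  have "\<exists>S. hits X S \<and> card S = nu X"
    unfolding nu_def by (rule LeastI_ex) (use hits_self in blast)
  then show ?thesis using that by blast
qed

lemma nu_le_card: "finite X \<Longrightarrow> nu X \<le> card X"
  using nu_le[OF hits_self, of X] card_mono[of X "X \<inter> V"] by auto

text \<open>The hypothesis is weaker than inclusion so that the lemma also yields
  \<open>nu V \<le> nu F\<close> for a member \<open>F\<close>, as every member meets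
  \<open>F\<close>.\<close>

lemma nu_mono: "(\<And>F. F \<in> \<F> \<Longrightarrow> F \<inter> X \<noteq> {} \<Longrightarrow> F \<inter> Y \<noteq> {}) \<Longrightarrow> nu X \<le> nu Y"
  using nu_attained[of Y] nu_le[of X] unfolding hits_def by metis

lemma nu_subset: "X \<subseteq> Y \<Longrightarrow> nu X \<le> nu Y"
  by (rule nu_mono) blast

lemma nu_empty: "nu {} = 0"
  using nu_le_card[of "{}"] by simp

lemma nu_Un: "nu (X \<union> Y) \<le> nu X + nu Y"
proof -
  obtain S T where S: "hits X S" "card S = nu X" and T: "hits Y T" "card T = nu Y"
    using nu_attained by metis
  have "hits (X \<union> Y) (S \<union> T)" using S T by (auto simp: hits_def Int_Un_distrib)
  then show ?thesis using nu_le card_Un_le[of S T] S(2) T(2) by fastforce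
qed

lemma nu_UN: "finite I \<Longrightarrow> nu (\<Union>i\<in>I. X i) \<le> (\<Sum>i\<in>I. nu (X i))"
proof (induction I rule: finite_induct)
  case (insert i I)
  then show ?case using nu_Un[of "X i" "\<Union>i\<in>I. X i"] by simp
qed (simp add: nu_empty)

lemma ex_avoiding:
  assumes "nu X < nu V"
  shows "\<exists>F\<in>\<F>. F \<inter> X = {}"
  using nu_mono[of V X] assms by force

lemma ex_avoiding_separator:
  assumes "finite S" "card S < nu X"
  shows "\<exists>F\<in>\<F>. F \<inter> X \<noteq> {} \<and> F \<inter> S = {}"
proof (rule ccontr)
  assume "\<not> ?thesis"
  then have "hits X (S \<inter> V)" using member_subset unfolding hits_def by blast
  then have "nu X \<le> card (S \<inter> V)" by (rule nu_le)
  also have "\<dots> \<le> card S" using assms(1) by (intro card_mono) auto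
  finally show False using assms(2) by simp
qed

text \<open>Appending one vertex raises \<open>nu\<close> by at most one, so the prefixes take all
  intermediate values.\<close>

lemma nu_prefix:
  assumes "j \<le> nu (set p)"
  obtains xs ys where "p = xs @ ys" "nu (set xs) = j"
proof -
  have "\<exists>xs ys. p = xs @ ys \<and> nu (set xs) = j"
    using assms
  proof (induction p rule: rev_induct)
    case Nil
    then show ?case by (auto simp: nu_empty)
  next
    case (snoc a p)
    show ?case
    proof (cases "j \<le> nu (set p)")
      case True
      with snoc show ?thesis by (metis append.assoc)
    next
      case False
      have "nu (set (p @ [a])) \<le> nu (set p) + nu {a}" using nu_Un[of "set p" "{a}"] by simp
      also have "nu {a} \<le> 1" using nu_le_card[of "{a}"] by simp
      finally have "nu (set (p @ [a])) = j" using False snoc.prems by simp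
      then show ?thesis by (intro exI[of _ "p @ [a]"] exI[of _ "[]"]) auto
    qed
  qed
  then show ?thesis using that by blast
qed

text \<open>A set \<open>S\<close> with fewer than \<open>k\<close> vertices misses a member
  \<open>F\<close> that meets \<open>A\<close> and a member \<open>F'\<close> that meets
  \<open>B\<close>. These two intersect and are connected, so their union contains a path from
  \<open>A\<close> to \<open>B\<close> that avoids \<open>S\<close>. Menger's theorem does the
  rest.\<close>

lemma linkage:
  assumes "finite A" "k \<le> nu A" "k \<le> nu B"
  obtains P where "disjoint_paths E A B P" "card P = k"
proof -
  have "k \<le> card S" if S: "finite S" "separates E A B S" for S
  proof (rule ccontr)
    assume "\<not> k \<le> card S"
    then have k: "card S < nu A" "card S < nu B" using assms by auto
    obtain F a where F: "F \<in> \<F>" "a \<in> F" "a \<in> A" "F \<inter> S = {}"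
      using ex_avoiding_separator[OF S(1) k(1)] by blast
    obtain F' b where F': "F' \<in> \<F>" "b \<in> F'" "b \<in> B" "F' \<inter> S = {}"
      using ex_avoiding_separator[OF S(1) k(2)] by blast
    obtain z where z: "z \<in> F" "z \<in> F'" using intersecting[OF F(1) F'(1)] by blast
    obtain p where p: "is_path E p" "hd p = a" "last p = z" "set p \<subseteq> F"
      using connected[OF F(1)] F z unfolding connected_in_def by blast
    obtain p' where p': "is_path E p'" "hd p' = z" "last p' = b" "set p' \<subseteq> F'"
      using connected[OF F'(1)] F' z unfolding connected_in_def by blast
    obtain l where l: "p' = z # l" using p'(1,2) by (cases p') (auto simp: is_path_def)
    have "p @ l \<noteq> []" "successively (\<lambda>u v. (u, v) \<in> E) (p @ l)" "hd (p @ l) = a" "last (p @ l) = b"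
      using p p' l by (auto simp: is_path_def successively_append_iff successively_Cons)
    then obtain r where "is_path E r" "hd r = a" "last r = b" "set r \<subseteq> set (p @ l)"
      using walk_imp_path by metis
    moreover have "set (p @ l) \<inter> S = {}" using p p' l F F' by auto
    ultimately show False using S(2) F F' unfolding separates_def by blast
  qed
  moreover have "finite E" using E_subset finite_V finite_subset by blast
  ultimately show ?thesis using menger[of E A B k] assms(1) that by blast
qed

lemma path_subset_V: "is_path E p \<Longrightarrow> hd p \<in> V \<Longrightarrow> set p \<subseteq> V"
  using walk_subset E_subset by (metis is_path_def)

text \<open>Averaging: the paths are disjoint, so their lengths add up to at most
  \<open>card V\<close>.\<close>

lemma short_path:
  assumes P: "disjoint_paths E A B P" and "A \<subseteq> V" "P \<noteq> {}"
  obtains p where "p \<in> P" "card P * length p \<le> card V"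
proof -
  have "\<exists>p\<in>P. card P * length p \<le> card V"
  proof (rule ccontr)
    assume "\<not> ?thesis"
    then have "\<And>p. p \<in> P \<Longrightarrow> card V < card P * length p" by auto
    then have "(\<Sum>p\<in>P. card V) < (\<Sum>p\<in>P. card P * length p)"
      using assms by (intro sum_strict_mono) (auto simp: disjoint_paths_def)
    also have "\<dots> = card P * (\<Sum>p\<in>P. card (set p))"
      using P by (auto simp: sum_distrib_left disjoint_paths_def is_path_def distinct_card intro!: sum.cong)
    also have "(\<Sum>p\<in>P. card (set p)) = card (\<Union>p\<in>P. set p)"
      using P by (intro card_UN_disjoint[symmetric]) (auto simp: disjoint_paths_def)
    also have "\<dots> \<le> card V"
      using P assms(2) path_subset_V finite_V
      by (intro card_mono UN_least) (auto simp: disjoint_paths_def)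
    finally show False by simp
  qed
  then show ?thesis using that by blast
qed

text \<open>The consecutive visits of \<open>Q\<close> to the path \<open>As @ Ms @ Bs\<close> jump over all of \<open>Ms\<close>, so one of
  the at most \<open>length Q\<close> jumps covers a large share of it.\<close>

lemma ex_jump:
  assumes dP: "distinct (As @ Ms @ Bs)" and Q: "is_path E Q" "hd Q \<in> set As" "last Q \<in> set Bs"
    and pos: "0 < nu (set Ms)"
  obtains Q1 u W v Q2 as ds bs where "Q = Q1 @ u # W @ v # Q2" "set W \<inter> set (As @ Ms @ Bs) = {}"
    "As @ Ms @ Bs = as @ ds @ bs" "ds \<noteq> []" "hd ds = u" "last ds = v" "u \<noteq> v"
    "nu (set Ms) \<le> length Q * nu (set ds)"
proof -
  define P where "P = As @ Ms @ Bs"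
  define ix where "ix = inv_into {..<length P} ((!) P)"
  have inj: "inj_on ((!) P) {..<length P}" using dP by (simp add: P_def inj_on_nth)
  have ix: "ix x < length P" "P ! ix x = x" if "x \<in> set P" for x
  proof -
    have "x \<in> (!) P ` {..<length P}" using that by (auto simp: in_set_conv_nth)
    then show "ix x < length P" "P ! ix x = x"
      unfolding ix_def using inv_into_into[of x "(!) P" "{..<length P}"] by (auto simp: f_inv_into_f)
  qed
  have ix_nth: "ix (P ! i) = i" if "i < length P" for i
    unfolding ix_def using inj that by (intro inv_into_f_f) auto
  \<comment> \<open>\<open>vis\<close> lists the visits of \<open>Q\<close> to \<open>P\<close> in
    the order of \<open>Q\<close>, and \<open>f k\<close> will be the position on \<open>P\<close>
    of visit \<open>k\<close>. These positions start before \<open>Ms\<close> and end after it, but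
    need not increase.\<close>
  define vis where "vis = filter (\<lambda>x. x \<in> set P) Q"
  have visP: "vis ! k \<in> set P" if "k < length vis" for k
    using nth_mem[OF that] by (auto simp: vis_def)
  define f where "f k = ix (vis ! k)" for k
  define N where "N = length vis - 1"
  have Qne: "Q \<noteq> []" using Q by (auto simp: is_path_def)
  have "hd Q \<in> set vis" using Q Qne by (auto simp: vis_def P_def)
  then have vne: "vis \<noteq> []" by auto
  have "vis ! 0 = hd Q" using Q(2) Qne by (cases Q) (auto simp: vis_def P_def)
  then have f0: "f 0 < length As"
  proof -
    obtain i where "i < length As" "As ! i = hd Q" using Q(2) by (auto simp: in_set_conv_nth)
    then show ?thesis using ix_nth[of i] \<open>vis ! 0 = hd Q\<close> by (simp add: f_def P_def nth_append)
  qed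
  have "last vis = last Q" using Q(3) Qne by (cases Q rule: rev_cases) (auto simp: vis_def P_def)
  then have fN: "length As + length Ms \<le> f N"
  proof -
    obtain i where "i < length Bs" "Bs ! i = last Q" using Q(3) by (auto simp: in_set_conv_nth)
    then have "P ! (length As + length Ms + i) = last Q" "length As + length Ms + i < length P"
      by (auto simp: P_def nth_append)
    moreover have "vis ! N = last Q" using \<open>last vis = last Q\<close> vne by (simp add: N_def last_conv_nth)
    ultimately show ?thesis using ix_nth[of "length As + length Ms + i"] by (simp add: f_def)
  qed
  \<comment> \<open>A backward jump gets the empty segment; the forward jumps suffice to cover
    \<open>Ms\<close>.\<close>
  define seg where "seg k = (!) P ` {f k..f (Suc k)}" for k
  have cover: "set Ms \<subseteq> (\<Union>k<N. seg k)"
  proof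
    fix x assume "x \<in> set Ms"
    then obtain i where i: "i < length Ms" "Ms ! i = x" by (auto simp: in_set_conv_nth)
    then have x: "P ! (length As + i) = x" by (simp add: P_def nth_append)
    have "f 0 \<le> length As + i" "length As + i < f N" using f0 fN i by auto
    then obtain k where "k < N" "f k \<le> length As + i" "length As + i \<le> f (Suc k)"
      using nat_intermediate_step by blast
    then have "x \<in> seg k" unfolding seg_def using x by (intro image_eqI[of _ _ "length As + i"]) auto
    then show "x \<in> (\<Union>k<N. seg k)" using \<open>k < N\<close> by blast
  qed
  have NQ: "N < length Q"
  proof -
    have "length vis \<le> length Q" by (simp add: vis_def)
    then show ?thesis using Qne unfolding N_def by (cases "length Q") auto
  qed
  \<comment> \<open>Pigeonhole by subadditivity: fewer than \<open>length Q\<close> segments cover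
    \<open>Ms\<close>.\<close>
  have "\<exists>k<N. nu (set Ms) \<le> length Q * nu (seg k)"
  proof (rule ccontr)
    assume "\<not> ?thesis"
    then have lt: "\<And>k. k < N \<Longrightarrow> length Q * nu (seg k) \<le> nu (set Ms)" by force
    have "length Q * nu (set Ms) \<le> length Q * (\<Sum>k<N. nu (seg k))"
      using nu_subset[OF cover] nu_UN[of "{..<N}" seg] by (intro mult_le_mono2) auto
    also have "\<dots> = (\<Sum>k<N. length Q * nu (seg k))" by (simp add: sum_distrib_left)
    also have "\<dots> \<le> (\<Sum>k<N. nu (set Ms))" using lt by (intro sum_mono) auto
    also have "\<dots> = N * nu (set Ms)" by simp
    also have "\<dots> < length Q * nu (set Ms)" using NQ pos by simp
    finally show False by simp
  qed
  then obtain k where k: "k < N" "nu (set Ms) \<le> length Q * nu (seg k)" by blast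
  have kv: "k < length vis" "Suc k < length vis" using k(1) by (auto simp: N_def)
  have "seg k \<noteq> {}" using k(2) pos nu_empty by (cases "seg k = {}") auto
  then have fk: "f k \<le> f (Suc k)" by (auto simp: seg_def)
  have fl: "f (Suc k) < length P" using ix(1)[OF visP[OF kv(2)]] by (simp add: f_def)
  \<comment> \<open>The stretch of \<open>P\<close> from position \<open>f k\<close> to position
    \<open>f (Suc k)\<close>, both included, hence the \<open>Suc\<close>.\<close>
  define ds where "ds = take (Suc (f (Suc k)) - f k) (drop (f k) P)"
  have len: "length ds = Suc (f (Suc k)) - f k" using fl fk by (simp add: ds_def)
  have nth: "ds ! i = P ! (f k + i)" if "i < length ds" for i
    using that len fl fk by (simp add: ds_def)
  have "set ds = seg k"
  proof -
    have "set ds = (!) ds ` {..<length ds}" by (auto simp: set_conv_nth)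
    also have "\<dots> = (\<lambda>i. P ! (f k + i)) ` {..<length ds}" using nth by (intro image_cong) auto
    also have "\<dots> = (!) P ` ((+) (f k) ` {..<length ds})" by (simp add: image_image)
    also have "(+) (f k) ` {..<length ds} = {f k..f (Suc k)}"
    proof -
      have "j \<in> (+) (f k) ` {..<length ds}" if "f k \<le> j" "j \<le> f (Suc k)" for j
        using that len by (intro image_eqI[of _ _ "j - f k"]) auto
      then show ?thesis using len fk by auto
    qed
    finally show ?thesis by (simp add: seg_def)
  qed
  then have nu_ds: "nu (set Ms) \<le> length Q * nu (set ds)" using k(2) by simp
  have dsne: "ds \<noteq> []" using len fk by auto
  have hd_ds: "hd ds = vis ! k"
    using nth[of 0] dsne ix(2)[OF visP[OF kv(1)]] by (simp add: hd_conv_nth f_def)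
  have last_ds: "last ds = vis ! Suc k"
    using nth[of "length ds - 1"] dsne len fk ix(2)[OF visP[OF kv(2)]] by (simp add: last_conv_nth f_def)
  have ne: "vis ! k \<noteq> vis ! Suc k"
    using Q(1) kv by (simp add: is_path_def vis_def nth_eq_iff_index_eq)
  have split: "As @ Ms @ Bs = take (f k) P @ ds @ drop (Suc (f (Suc k)) - f k) (drop (f k) P)"
    unfolding P_def[symmetric] ds_def by (simp only: append_take_drop_id)
  have "vis = take k vis @ vis ! k # vis ! Suc k # drop (Suc (Suc k)) vis"
    using kv by (simp add: id_take_nth_drop[symmetric] Cons_nth_drop_Suc)
  then obtain Q1 W Q2 where W: "Q = Q1 @ vis ! k # W @ vis ! Suc k # Q2" "\<forall>y\<in>set W. y \<notin> set P"
    using consecutive_in_filter[of "\<lambda>x. x \<in> set P" Q] unfolding vis_def[symmetric] by blast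
  show ?thesis
    by (rule that[OF W(1) _ split dsne hd_ds last_ds ne nu_ds]) (use W(2) in \<open>auto simp: P_def\<close>)
qed

end

text \<open>The arithmetic of \<open>nu_bound\<close>: \<open>l\<close> will be the length of a
  short path \<open>Q\<close> and \<open>s\<close> the value of \<open>nu\<close> on a cycle. The
  second claim provides a member avoiding the cycle, the third is the final contradiction. The
  constant is \<open>4096 = 8 ^ 4\<close>.\<close>

lemma transversal_arith:
  fixes t m n r :: nat
  assumes m: "m \<ge> 1" and tn: "t \<le> n" and big: "4096 * m ^ 5 * n ^ 3 < t ^ 4" and r: "r = t div (4 * m)"
  shows "0 < r"
    and "r * l \<le> n \<Longrightarrow> 3 * r + l < t"
    and "r * l \<le> n \<Longrightarrow> r \<le> l * s \<Longrightarrow> s \<le> n \<Longrightarrow> s * s \<le> 2 * m * n + m * s \<Longrightarrow> False"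
proof -
  \<comment> \<open>As \<open>t \<le> n\<close>, a factor \<open>t ^ 3\<close> cancels from
    \<open>big\<close>, so \<open>t\<close> is large compared with \<open>m\<close>. Then
    \<open>r \<ge> 4\<close>, and rounding in the division costs little.\<close>
  have "4096 * m ^ 5 * t ^ 3 \<le> 4096 * m ^ 5 * n ^ 3" using tn by (intro mult_le_mono2 power_mono) auto
  also note big
  also have "t ^ 4 = t * t ^ 3" by (simp add: eval_nat_numeral)
  finally have "4096 * m ^ 5 * t ^ 3 < t * t ^ 3" .
  then have "4096 * m ^ 5 < t" by (meson mult_less_cancel2)
  moreover have "m * 1 \<le> m * m ^ 4" using m by (intro mult_le_mono2) auto
  then have "m \<le> m ^ 5" by (simp add: power_Suc[symmetric] del: power_Suc)
  ultimately have tm: "4096 * m < t" by linarith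
  have "4 * (4 * m) div (4 * m) \<le> t div (4 * m)" using tm by (intro div_le_mono) auto
  then have r4: "4 \<le> r" using m by (simp add: r)
  then show "0 < r" by simp
  have lo: "4 * m * r \<le> t" unfolding r by simp
  \<comment> \<open>The remainder is below \<open>4 * m \<le> m * r\<close>, so it costs only one
    more multiple of \<open>m * r\<close>.\<close>
  have "t < 4 * m * r + 4 * m"
    using m mult_div_mod_eq[of "4 * m" t] mod_less_divisor[of "4 * m" t] unfolding r by linarith
  also have "\<dots> \<le> 4 * m * r + m * r" using r4 by simp
  finally have hi: "t \<le> 5 * m * r" by simp
  have tt: "t ^ 4 = (t * t) * (t * t)" by (simp add: power4_eq_xxxx)
  {
    assume l: "r * l \<le> n"
    \<comment> \<open>Otherwise \<open>t\<^sup>2 \<le> 20 * m * n\<close>, and squaring contradicts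
      \<open>big\<close>.\<close>
    have "4 * l < t"
    proof (rule ccontr)
      assume "\<not> 4 * l < t"
      then have "t * t \<le> (5 * m * r) * (4 * l)" using hi by (intro mult_le_mono) auto
      also have "\<dots> = 20 * m * (r * l)" by simp
      also have "\<dots> \<le> 20 * m * n" using l by simp
      finally have t2: "t * t \<le> 20 * m * n" .
      have "t ^ 4 \<le> (20 * m * n) * (20 * m * n)" unfolding tt by (rule mult_le_mono[OF t2 t2])
      also have "\<dots> = 400 * (m ^ 2 * n ^ 2)" by (simp add: power2_eq_square)
      also have "\<dots> \<le> 4096 * (m ^ 5 * n ^ 3)"
        using m power_increasing[of 2 5 m] power_increasing[of 2 3 n] tn tm
        by (intro mult_le_mono) auto
      finally show False using big by simp
    qed
    moreover have "4 * r \<le> t" using lo m by (metis le_trans mult.assoc mult_le_mono1 mult_1 mult.left_commute mult_le_mono2)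
    ultimately show "3 * r + l < t" by linarith
  }
  assume l: "r * l \<le> n" "r \<le> l * s" "s \<le> n" and s: "s * s \<le> 2 * m * n + m * s"
  have "r * r \<le> r * (l * s)" using l by simp
  also have "\<dots> = (r * l) * s" by simp
  also have "\<dots> \<le> n * s" using l by simp
  finally have rr: "r * r \<le> n * s" .
  have "m * s \<le> m * n" using l by simp
  moreover have "3 * m * n = 2 * m * n + m * n" by simp
  ultimately have ss: "s * s \<le> 3 * m * n" using s by linarith
  have "t * t \<le> (5 * m * r) * (5 * m * r)" using hi by (intro mult_le_mono)
  also have "\<dots> = 25 * m * m * (r * r)" by simp
  also have "\<dots> \<le> 25 * m * m * (n * s)" using rr by (rule mult_le_mono2)
  finally have t2: "t * t \<le> 25 * m * m * (n * s)" .
  have "t ^ 4 \<le> (25 * m * m * (n * s)) * (25 * m * m * (n * s))" unfolding tt by (rule mult_le_mono[OF t2 t2])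
  also have "\<dots> = 625 * (m * m * m * m * n * n) * (s * s)" by simp
  also have "\<dots> \<le> 625 * (m * m * m * m * n * n) * (3 * m * n)" using ss by (rule mult_le_mono2)
  also have "\<dots> = 1875 * (m ^ 5 * n ^ 3)"
  proof -
    have "m ^ 5 = m * m * m * m * m" "n ^ 3 = n * n * n" by (simp_all add: eval_nat_numeral)
    then show ?thesis by simp
  qed
  finally show False using big by simp
qed

section \<open>The cycle bound and the bound on the hitting number\<close>

context linked_family
begin

text \<open>Two links from the cycle \<open>c\<close> to the same detour-free path, together with the longer arc of
  \<open>c\<close> between their ends, form a detour; so the links arrive far apart.\<close>

lemma cycle_bound:
  assumes c: "distinct c" "successively (\<lambda>u v. (u, v) \<in> E) c" "(last c, hd c) \<in> E"
    and F: "F \<in> \<F>" "set c \<inter> F = {}"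
    and \<P>: "finite \<P>" "card \<P> \<le> m" "F = \<Union> (set ` \<P>)" "\<And>p. p \<in> \<P> \<Longrightarrow> is_path E p \<and> detour_free E F p"
  shows "nu (set c) * nu (set c) \<le> 2 * m * card V + m * nu (set c)"
proof -
  define s where "s = nu (set c)"
  \<comment> \<open>Every member meets \<open>F\<close>, so \<open>nu F\<close> is at least
    \<open>nu\<close> of any set, and the number of links is limited only by the cycle.\<close>
  have "s \<le> nu F" unfolding s_def using nu_mono[of "set c" F] intersecting[OF _ F(1)] by blast
  then obtain P where P: "disjoint_paths E (set c) F P" "card P = s"
    using linkage[of "set c" s F] s_def by auto
  have "\<exists>x l y. is_path E (x # l @ [y]) \<and> x \<in> set c \<and> y \<in> F \<and> set l \<inter> (set c \<union> F) = {} \<and>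
      set (x # l @ [y]) \<subseteq> set p" if "p \<in> P" for p
    using path_trim[of E p "set c" F] P(1) that F(2) by (auto simp: disjoint_paths_def)
  then obtain X L Y where XLY: "\<And>p. p \<in> P \<Longrightarrow> is_path E (X p # L p @ [Y p]) \<and> X p \<in> set c \<and> Y p \<in> F \<and>
      set (L p) \<inter> (set c \<union> F) = {} \<and> set (X p # L p @ [Y p]) \<subseteq> set p" by metis
  have disj: "set p \<inter> set q = {}" if "p \<in> P" "q \<in> P" "p \<noteq> q" for p q
    using P(1) that by (auto simp: disjoint_paths_def)
  have inj: "inj_on Y P"
  proof (rule inj_onI, rule ccontr)
    fix p q assume "p \<in> P" "q \<in> P" "Y p = Y q" "p \<noteq> q"
    then show False using disj[of p q] XLY[of p] XLY[of q] by auto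
  qed
  \<comment> \<open>A link end lying on several paths of \<open>\<P>\<close> is counted for each of
    them, so \<open>s\<close> is only bounded above by the sum.\<close>
  define T where "T p = {y \<in> Y ` P. y \<in> set p}" for p
  have finP: "finite P" using P(1) by (simp add: disjoint_paths_def)
  have "Y ` P = (\<Union>p\<in>\<P>. T p)" using XLY \<P>(3) by (auto simp: T_def)
  then have "s \<le> (\<Sum>p\<in>\<P>. card (T p))"
    using card_UN_le[OF \<P>(1), of T] card_image[OF inj] P(2) by simp
  have seg: "(card (T p) - 1) * s \<le> 2 * card V" if p: "p \<in> \<P>" for p
  proof -
    define I where "I = {i. i < length p \<and> p ! i \<in> T p}"
    have dp: "distinct p" "is_path E p" "detour_free E F p" using \<P>(4)[OF p] by (auto simp: is_path_def)
    have "(!) p ` I = T p"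
    proof
      show "T p \<subseteq> (!) p ` I"
      proof
        fix y assume y: "y \<in> T p"
        then obtain i where "i < length p" "p ! i = y" by (auto simp: T_def in_set_conv_nth)
        with y show "y \<in> (!) p ` I" by (auto simp: I_def)
      qed
    qed (auto simp: I_def)
    moreover have "inj_on ((!) p) I" using dp(1) by (intro inj_on_nth) (auto simp: I_def)
    ultimately have cI: "card I = card (T p)" by (metis card_image)
    have "(card I - 1) * length c \<le> 2 * length p"
    proof (rule spread_card)
      fix i j assume ij: "i \<in> I" "j \<in> I" "i < j"
      then obtain a b where a: "a \<in> P" "p ! i = Y a" and b: "b \<in> P" "p ! j = Y b" and j: "j < length p"
        by (auto simp: I_def T_def)
      have "Y a \<noteq> Y b" using dp(1) ij(3) j a b by (metis less_trans nat_neq_iff nth_eq_iff_index_eq)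
      then have ab: "set a \<inter> set b = {}" using disj a b by blast
      have Xab: "X a \<noteq> X b" "X a \<in> set c" "X b \<in> set c" using ab XLY[OF a(1)] XLY[OF b(1)] by auto
      obtain Z where Z: "is_path E Z" "hd Z = X a" "last Z = X b" "set Z \<subseteq> set c" "length c \<le> 2 * length Z"
        using cycle_arc[OF c(1-3) sym_E Xab(2,3,1)] by blast
      obtain Z' where Z': "Z = X a # Z'" using Z(1,2) by (cases Z) (auto simp: is_path_def)
      obtain Z'' where Z'': "Z = Z'' @ [X b]" using Z(1,3) by (cases Z rule: rev_cases) (auto simp: is_path_def)
      \<comment> \<open>The detour leaves \<open>Y a\<close> along the first link, runs over the
        long arc \<open>Z\<close> and reaches \<open>Y b\<close> along the second link. It avoids
        \<open>F\<close>, so its length is at most the number of vertices of \<open>p\<close>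
        strictly between positions \<open>i\<close> and \<open>j\<close>.\<close>
      define W where "W = rev (L a) @ Z @ L b"
      have La: "is_path E (X a # L a @ [Y a])" "set (L a) \<inter> (set c \<union> F) = {}" "Y a \<in> F" "set (X a # L a @ [Y a]) \<subseteq> set a"
        using XLY[OF a(1)] by auto
      have Lb: "is_path E (X b # L b @ [Y b])" "set (L b) \<inter> (set c \<union> F) = {}" "Y b \<in> F" "set (X b # L b @ [Y b]) \<subseteq> set b"
        using XLY[OF b(1)] by auto
      have "is_path E (Z'' @ X b # (L b @ [Y b]))"
      proof (rule is_path_glue)
        have "set Z'' \<subseteq> set c" using Z(4) Z'' by auto
        then show "set Z'' \<inter> set (L b @ [Y b]) = {}" using Lb(2,3) F(2) by auto
      qed (use Z(1) Lb(1) Z'' in auto)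
      then have 1: "is_path E (X a # (Z' @ L b @ [Y b]))" using Z' Z'' by (metis append_Cons append_assoc append_Nil)
      have "is_path E (rev (X a # L a @ [Y a]))" using is_path_rev[OF sym_E La(1)] .
      then have 2: "is_path E ((Y a # rev (L a)) @ [X a])" by simp
      have "is_path E ((Y a # rev (L a)) @ X a # (Z' @ L b @ [Y b]))"
      proof (rule is_path_glue[OF 2 1])
        have "set Z' \<subseteq> set c" using Z(4) Z' by auto
        then show "set (Y a # rev (L a)) \<inter> set (Z' @ L b @ [Y b]) = {}"
          using La(2-4) Lb(2-4) ab F(2) by fastforce
      qed
      then have "is_path E (Y a # W @ [Y b])" using Z' by (simp add: W_def)
      moreover have "set W \<inter> F = {}" using La(2) Lb(2) Z(4) F(2) by (auto simp: W_def)
      moreover have "W \<noteq> []" using Z' by (simp add: W_def)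
      moreover have "p = take i p @ Y a # take (j - Suc i) (drop (Suc i) p) @ Y b # drop (Suc j) p"
      proof -
        have "drop i p = p ! i # drop (Suc i) p" using ij j by (simp add: Cons_nth_drop_Suc)
        moreover have "drop (Suc i) p = take (j - Suc i) (drop (Suc i) p) @ drop j p"
          using ij(3) append_take_drop_id[of "j - Suc i" "drop (Suc i) p"] by simp
        moreover have "drop j p = p ! j # drop (Suc j) p" using j by (simp add: Cons_nth_drop_Suc)
        ultimately show ?thesis using a(2) b(2) by (metis append_take_drop_id)
      qed
      ultimately have "length W \<le> length (take (j - Suc i) (drop (Suc i) p))"
        using dp(3) unfolding detour_free_def by blast
      moreover have "length Z \<le> length W" by (simp add: W_def)
      ultimately have "length Z \<le> j - i" by (simp, arith)
      then show "length c \<le> 2 * (j - i)" using Z(5) by linarith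
    qed (auto simp: I_def)
    then have "(card (T p) - 1) * length c \<le> 2 * length p" unfolding cI .
    moreover have "length p \<le> card V"
    proof -
      have "set p \<subseteq> V" using member_subset[OF F(1)] \<P>(3) p by auto
      then show ?thesis using card_mono[OF finite_V] dp(1) by (metis distinct_card)
    qed
    moreover have "s \<le> length c" unfolding s_def using nu_le_card[of "set c"] c(1) by (simp add: distinct_card)
    then have "(card (T p) - 1) * s \<le> (card (T p) - 1) * length c" by (rule mult_le_mono2)
    ultimately show ?thesis by linarith
  qed
  \<comment> \<open>The extra \<open>s\<close> makes up for the \<open>- 1\<close> and also covers
    an empty \<open>T p\<close>.\<close>
  have "card (T p) * s \<le> 2 * card V + s" if "p \<in> \<P>" for p
    using seg[OF that] by (cases "card (T p)") auto
  then have "(\<Sum>p\<in>\<P>. card (T p) * s) \<le> (\<Sum>p\<in>\<P>. 2 * card V + s)" by (rule sum_mono)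
  also have "\<dots> \<le> m * (2 * card V + s)" using \<P>(2) by simp
  finally have "(\<Sum>p\<in>\<P>. card (T p)) * s \<le> m * (2 * card V + s)" by (simp add: sum_distrib_right)
  moreover have "s * s \<le> (\<Sum>p\<in>\<P>. card (T p)) * s"
    using \<open>s \<le> (\<Sum>p\<in>\<P>. card (T p))\<close> by (rule mult_le_mono1)
  ultimately have "s * s \<le> m * (2 * card V + s)" by (rule order_trans[rotated])
  then show ?thesis unfolding s_def[symmetric] by (simp add: algebra_simps)
qed

theorem nu_bound:
  assumes m: "m \<ge> 1"
    and cover: "\<And>F. F \<in> \<F> \<Longrightarrow> \<exists>\<P>. finite \<P> \<and> card \<P> \<le> m \<and> F = \<Union> (set ` \<P>) \<and>
      (\<forall>p\<in>\<P>. is_path E p \<and> detour_free E F p)"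
  shows "nu V ^ 4 \<le> 4096 * m ^ 5 * card V ^ 3"
proof (rule ccontr)
  define t n where "t = nu V" and "n = card V"
  define r where "r = t div (4 * m)"
  assume "\<not> ?thesis"
  then have big: "4096 * m ^ 5 * n ^ 3 < t ^ 4" by (simp add: t_def n_def)
  have tn: "t \<le> n" unfolding t_def n_def by (rule nu_le_card[OF finite_V])
  note arith = transversal_arith[OF m tn big r_def]
  have rt: "4 * m * r \<le> t" unfolding r_def by simp
  have "\<exists>F0\<in>\<F>. F0 \<inter> {} = {}"
  proof (rule ex_avoiding)
    have "0 < t" using arith(1) by (cases "t = 0") (auto simp: r_def)
    then show "nu {} < nu V" using nu_empty by (simp add: t_def)
  qed
  then obtain F0 where F0: "F0 \<in> \<F>" by blast
  obtain \<P> where \<P>: "finite \<P>" "card \<P> \<le> m" "F0 = \<Union> (set ` \<P>)" "\<forall>p\<in>\<P>. is_path E p"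
    using cover[OF F0] by blast
  have "t \<le> nu F0" unfolding t_def using nu_mono[of V F0] intersecting[OF _ F0] by blast
  also have "\<dots> \<le> (\<Sum>p\<in>\<P>. nu (set p))" unfolding \<P>(3) by (rule nu_UN[OF \<P>(1)])
  finally have sum: "t \<le> (\<Sum>p\<in>\<P>. nu (set p))" .
  \<comment> \<open>At most \<open>m\<close> paths share a total of at least
    \<open>t \<ge> 4 * m * r\<close>; the amount \<open>3 * r\<close> suffices for
    \<open>As\<close>, \<open>Ms\<close> and \<open>Bs\<close>.\<close>
  have "\<exists>p\<in>\<P>. 3 * r \<le> nu (set p)"
  proof (rule ccontr)
    assume "\<not> ?thesis"
    then have "(\<Sum>p\<in>\<P>. nu (set p)) \<le> (\<Sum>p\<in>\<P>. 3 * r)" by (intro sum_mono) force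
    also have "\<dots> \<le> m * (3 * r)" using \<P>(2) by simp
    also have "\<dots> < 4 * m * r" using m arith(1) by simp
    finally show False using sum rt by simp
  qed
  then obtain p where p: "p \<in> \<P>" "3 * r \<le> nu (set p)" by blast
  \<comment> \<open>The prefix is cut at exactly \<open>3 * r\<close> because
    \<open>nu (set P1)\<close> must stay small enough for some member to avoid \<open>P1\<close> and
    \<open>Q\<close>.\<close>
  obtain P1 rest where P1: "p = P1 @ rest" "nu (set P1) = 3 * r" using nu_prefix[OF p(2)] .
  obtain As R1 where As: "P1 = As @ R1" "nu (set As) = r" using nu_prefix[of r P1] P1(2) by auto
  have "2 * r \<le> nu (set R1)" using nu_Un[of "set As" "set R1"] As P1(2) by simp
  then obtain Ms Bs where Ms: "R1 = Ms @ Bs" "nu (set Ms) = r" using nu_prefix[of r R1] by auto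
  have Bs: "r \<le> nu (set Bs)" using nu_Un[of "set Ms" "set Bs"] Ms \<open>2 * r \<le> nu (set R1)\<close> by simp
  have P1_eq: "P1 = As @ Ms @ Bs" using As Ms by simp
  have pathP1: "is_path E p" "set p \<subseteq> V" using \<P> p member_subset[OF F0] by auto
  have dP1: "distinct (As @ Ms @ Bs)" using pathP1 P1 P1_eq by (auto simp: is_path_def)
  have sP1: "successively (\<lambda>u v. (u, v) \<in> E) (As @ Ms @ Bs)"
  proof -
    have "successively (\<lambda>u v. (u, v) \<in> E) ((As @ Ms @ Bs) @ rest)"
      using pathP1(1) P1(1) P1_eq by (simp add: is_path_def)
    then show ?thesis by (simp only: successively_append_iff)
  qed
  have P1V: "set (As @ Ms @ Bs) \<subseteq> V" using pathP1 P1 P1_eq by auto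
  obtain LL where LL: "disjoint_paths E (set As) (set Bs) LL" "card LL = r"
    using linkage[of "set As" r "set Bs"] As Bs by auto
  obtain Q where Q: "Q \<in> LL" "r * length Q \<le> n"
    using short_path[OF LL(1)] LL(2) P1V arith(1) unfolding n_def by force
  have Qp: "is_path E Q" "hd Q \<in> set As" "last Q \<in> set Bs" using LL(1) Q(1) by (auto simp: disjoint_paths_def)
  obtain Q1 u W v Q2 as ds bs where J: "Q = Q1 @ u # W @ v # Q2" "set W \<inter> set (As @ Ms @ Bs) = {}"
    "As @ Ms @ Bs = as @ ds @ bs" "ds \<noteq> []" "hd ds = u" "last ds = v" "u \<noteq> v"
    "nu (set Ms) \<le> length Q * nu (set ds)"
  proof -
    have "0 < nu (set Ms)" using Ms(2) arith(1) by simp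
    from ex_jump[OF dP1 Qp this] show ?thesis using that by blast
  qed
  \<comment> \<open>The cycle follows \<open>P1\<close> from \<open>u\<close> to \<open>v\<close>
    and returns along the jump. For \<open>W = []\<close> and \<open>ds = [u, v]\<close> it
    degenerates to one edge run both ways, which \<open>cycle_bound\<close> admits.\<close>
  define c where "c = ds @ rev W"
  have uWv: "is_path E (u # W @ [v])"
    using Qp(1) unfolding J(1) is_path_def by (auto simp: successively_append_iff successively_Cons hd_append)
  have "distinct c"
    using dP1 uWv J(2) unfolding c_def J(3) by (auto simp: is_path_def)
  moreover have "successively (\<lambda>u v. (u, v) \<in> E) c \<and> (last c, hd c) \<in> E"
  proof -
    have "successively (\<lambda>u v. (u, v) \<in> E) ds" using sP1 unfolding J(3) by (auto simp: successively_append_iff)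
    moreover have "successively (\<lambda>u v. (u, v) \<in> E) (rev (u # W @ [v]))"
      using is_path_rev[OF sym_E uWv] by (simp add: is_path_def)
    ultimately show ?thesis
      using J(4-6) by (cases "W = []") (auto simp: c_def successively_append_iff successively_Cons hd_append last_rev)
  qed
  moreover have cPQ: "set c \<subseteq> set P1 \<union> set Q" unfolding c_def P1_eq J(1,3) by auto
  moreover have cV: "set c \<subseteq> V"
  proof -
    have "hd Q \<in> V" using Qp(2) P1V by auto
    then show ?thesis using cPQ P1V P1_eq path_subset_V[OF Qp(1)] by blast
  qed
  \<comment> \<open>The cycle lies in \<open>P1\<close> and \<open>Q\<close>, whose union has
    \<open>nu\<close> at most \<open>3 * r + length Q < t\<close>.\<close>
  moreover have "\<exists>F\<in>\<F>. F \<inter> (set P1 \<union> set Q) = {}"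
  proof (rule ex_avoiding)
    have "nu (set P1 \<union> set Q) \<le> 3 * r + length Q"
      using nu_Un[of "set P1" "set Q"] P1(2) nu_le_card[of "set Q"] card_length[of Q] by simp
    then show "nu (set P1 \<union> set Q) < nu V" using arith(2)[OF Q(2)] by (simp add: t_def)
  qed
  then obtain F where F: "F \<in> \<F>" "F \<inter> (set P1 \<union> set Q) = {}" by blast
  moreover obtain PF where "finite PF" "card PF \<le> m" "F = \<Union> (set ` PF)"
      "\<forall>p\<in>PF. is_path E p \<and> detour_free E F p"
    using cover[OF F(1)] by blast
  ultimately have "nu (set c) * nu (set c) \<le> 2 * m * n + m * nu (set c)"
    unfolding n_def by (intro cycle_bound[of c F PF m]) auto
  \<comment> \<open>Together with \<open>r * length Q \<le> n\<close> this gives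
    \<open>r * r \<le> n * nu (set c)\<close>.\<close>
  moreover have "r \<le> length Q * nu (set c)"
  proof -
    have "nu (set ds) \<le> nu (set c)" by (rule nu_subset) (auto simp: c_def)
    then show ?thesis using J(8) Ms(2) by (metis le_trans mult_le_mono2)
  qed
  moreover have "nu (set c) \<le> n"
    using nu_le_card[of "set c"] card_mono[OF finite_V cV] by (simp add: n_def)
  ultimately show False using arith(3)[OF Q(2)] by blast
qed

end

section \<open>From the hitting number to transversals of maximum subdivisions\<close>

theorem theorem1:
  fixes R :: "('a, 'b) mgraph" and G :: "('v, 'e) mgraph" and m n :: nat
  assumes "multigraph R" and "connected_mgraph R" and "card (edges R) = m" and "m \<ge> 1"
    and "simple_graph G" and "card (verts G) = n"
    and "\<And>H H'. is_max_subdivision_in R G H \<Longrightarrow> is_max_subdivision_in R G H' \<Longrightarrow>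
           verts H \<inter> verts H' \<noteq> {}"
  shows "real (tau R G) \<le> 8 * real m powr (5 / 4) * real n powr (3 / 4)"
proof -
  \<comment> \<open>If \<open>G\<close> contains no subdivision of \<open>R\<close>, this family is
    empty and all values of \<open>nu\<close> are \<open>0\<close>.\<close>
  define \<F> where "\<F> = {verts H | H. is_max_subdivision_in R G H}"
  have G: "multigraph G" using assms(5) by (simp add: simple_graph_def)
  have R: "edges R \<noteq> {}" using assms(3,4) by auto
  have sub: "subgraph_of H G" if "is_max_subdivision_in R G H" for H
    using that by (auto simp: is_max_subdivision_in_def is_subdivision_in_def)
  have model: "\<exists>\<phi> p q. topological_model R H \<phi> p q" if "is_max_subdivision_in R G H" for H
  proof -
    have "is_subdivision_in R G H" using that by (simp add: is_max_subdivision_in_def)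
    from subdivision_imp_model[OF assms(1) this] show ?thesis by blast
  qed
  interpret linked_family "verts G" "adj_rel G" \<F>
  proof
    fix F assume "F \<in> \<F>"
    then obtain H where H: "is_max_subdivision_in R G H" "F = verts H" by (auto simp: \<F>_def)
    show "F \<subseteq> verts G" using sub[OF H(1)] H(2) by (simp add: subgraph_of_def)
    show "connected_in (adj_rel G) F"
      using model[OF H(1)] subdivision_connected[OF assms(1,2) R _ sub[OF H(1)]] H(2) by blast
  next
    fix F F' assume "F \<in> \<F>" "F' \<in> \<F>"
    then show "F \<inter> F' \<noteq> {}" using assms(7) by (auto simp: \<F>_def)
  qed (use G in \<open>simp_all add: multigraph.finite_verts adj_rel_subset sym_adj_rel\<close>)
  have bound: "nu (verts G) ^ 4 \<le> 4096 * m ^ 5 * card (verts G) ^ 3"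
  proof (rule nu_bound[OF assms(4)])
    fix F assume "F \<in> \<F>"
    then obtain H where H: "is_max_subdivision_in R G H" "F = verts H" by (auto simp: \<F>_def)
    then obtain \<phi> p q where M: "topological_model R H \<phi> p q" using model by blast
    have fin: "finite (edges R)" using assms(1) by (rule multigraph.finite_edges)
    show "\<exists>\<P>. finite \<P> \<and> card \<P> \<le> m \<and> F = \<Union> (set ` \<P>) \<and>
      (\<forall>p\<in>\<P>. is_path (adj_rel G) p \<and> detour_free (adj_rel G) F p)"
    \<comment> \<open>The model paths serve as the cover, one for each edge of
      \<open>R\<close>.\<close>
    proof (intro exI[of _ "p ` edges R"] conjI ballI)
      show "card (p ` edges R) \<le> m" using card_image_le[OF fin] assms(3) by simp
      show "F = \<Union> (set ` p ` edges R)"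
        using model_verts_connected[OF assms(1,2) R M] H(2) by simp
    qed (use fin model_path[OF M sub[OF H(1)]] max_subdivision_detour_free[OF assms(1) G H(1) M] H(2) in auto)
  qed
  obtain S where S: "hits (verts G) S" "card S = nu (verts G)" using nu_attained .
  have "transversal R G S"
    unfolding transversal_def
  proof (intro conjI allI impI)
    show "S \<subseteq> verts G" using S(1) by (simp add: hits_def)
    fix H assume H: "is_max_subdivision_in R G H"
    \<comment> \<open>The intersection hypothesis applied to \<open>H\<close> and itself shows that
      \<open>verts H\<close> is nonempty.\<close>
    then have "verts H \<in> \<F>" "verts H \<inter> verts G \<noteq> {}"
      using assms(7)[OF H H] sub[OF H] by (auto simp: \<F>_def subgraph_of_def)
    then show "S \<inter> verts H \<noteq> {}" using S(1) by (auto simp: hits_def Int_commute)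
  qed
  then have "tau R G \<le> nu (verts G)" unfolding tau_def using S(2) by (intro Least_le) blast
  then have "tau R G ^ 4 \<le> nu (verts G) ^ 4" by (rule power_mono) simp
  also note bound
  finally have "real (tau R G ^ 4) \<le> real (4096 * m ^ 5 * n ^ 3)" unfolding assms(6) of_nat_le_iff .
  then have le: "real (tau R G) ^ 4 \<le> 4096 * real m ^ 5 * real n ^ 3" by simp
  show ?thesis
  \<comment> \<open>Fourth powers are compared: there \<open>8\<close> becomes \<open>4096\<close>
    and the real exponents become \<open>5\<close> and \<open>3\<close>.\<close>
  proof (rule power_le_imp_le_base[of _ 3])
    have "(real m powr (5 / 4)) ^ 4 = real m ^ 5" using assms(4) by (simp add: powr_power)
    moreover have "(real n powr (3 / 4)) ^ 4 = real n ^ 3" by (cases "n = 0") (simp_all add: powr_power)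
    ultimately have "(8 * real m powr (5 / 4) * real n powr (3 / 4)) ^ 4 = 4096 * real m ^ 5 * real n ^ 3"
      by (simp only: power_mult_distrib) simp
    moreover have "Suc 3 = 4" by simp
    ultimately show "real (tau R G) ^ Suc 3 \<le> (8 * real m powr (5 / 4) * real n powr (3 / 4)) ^ Suc 3"
      using le by (simp only:)
  qed simp
qed

end
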